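(* Let $T$ be a commutative linear algebraic group over a field $L$ of characteristic zero whose identity component $T^\circ$ is isomorphic to $\mathbb G_{m,L}^r\times_L\mathbb G_{a,L}^n$ for some $r,n\ge0$. Let $G\subset T(L)$ be an infinite cyclic subgroup which is Zariski-dense in $T$. Then $n=0$ or $n=1$, and for every connected component $T^c$ of $T$, every infinite subset $S$ of $G\cap T^c$ is Zariski-dense in $T^c$. *)

theory Defs
  imports
    "HOL-Analysis.Analysis"
    "HOL-Algebra.Algebraic_Closure_Type"
    "HOL-Algebra.Product_Groups"
    "HOL-Algebra.Elementary_Groups"
    "HOL-Library.Poly_Mapping"
begin

no_notation Polynomials.var (\<open>X\<index>\<close>)
no_notation eq_closure_of (\<open>closure'_of\<index>\<close>)

text \<open>
  The ground field \<open>L\<close> is the type \<open>'l\<close>; \<open>'l alg_closure\<close> is its algebraic closure, with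
  embedding \<^const>\<open>to_ac\<close>. A linear algebraic group over \<open>L\<close> is represented by its set of
  points over the algebraic closure, as a subgroup of \<open>GL_m\<close> cut out by polynomials with
  coefficients in \<open>L\<close>. In characteristic zero group schemes of finite type are reduced
  and \<open>L\<close> is perfect, so this determines the group over \<open>L\<close>.
\<close>

subsection \<open>Polynomials over the ground field\<close>

type_synonym ('v, 'l) mpoly = "('v \<Rightarrow>\<^sub>0 nat) \<Rightarrow>\<^sub>0 'l"

definition peval :: "('v, 'l::field) mpoly \<Rightarrow> ('v \<Rightarrow> 'l alg_closure) \<Rightarrow> 'l alg_closure" where
  "peval p x = (\<Sum>m\<in>Poly_Mapping.keys p. to_ac (Poly_Mapping.lookup p m) *
     (\<Prod>v\<in>Poly_Mapping.keys m. x v ^ Poly_Mapping.lookup m v))"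

lemma peval_superset:
  assumes "finite A" "Poly_Mapping.keys p \<subseteq> A"
  shows "peval p x = (\<Sum>m\<in>A. to_ac (Poly_Mapping.lookup p m) *
     (\<Prod>v\<in>Poly_Mapping.keys m. x v ^ Poly_Mapping.lookup m v))"
  unfolding peval_def
  by (rule sum.mono_neutral_left) (use assms in \<open>auto simp: in_keys_iff\<close>)

lemma peval_0 [simp]: "peval 0 x = 0"
  by (simp add: peval_def)

lemma peval_1 [simp]: "peval 1 x = 1"
  by (simp add: peval_def)

lemma peval_add: "peval (p + q) x = peval p x + peval q x"
proof -
  let ?A = "Poly_Mapping.keys p \<union> Poly_Mapping.keys q"
  have "Poly_Mapping.keys (p + q) \<subseteq> ?A"
    by (rule Poly_Mapping.keys_add)
  then show ?thesis
    using peval_superset[of ?A p x] peval_superset[of ?A q x] peval_superset[of ?A "p + q" x]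
    by (simp add: lookup_add distrib_right sum.distrib)
qed

lemma peval_sum: "peval (\<Sum>i\<in>I. p i) x = (\<Sum>i\<in>I. peval (p i) x)"
  by (induction I rule: infinite_finite_induct) (simp_all add: peval_add)

lemma peval_single:
  "peval (Poly_Mapping.single m a) x =
     to_ac a * (\<Prod>v\<in>Poly_Mapping.keys m. x v ^ Poly_Mapping.lookup m v)"
  by (subst peval_superset[of "{m}"]) auto

lemma monomial_eval_add:
  fixes x :: "'v \<Rightarrow> 'a::comm_semiring_1"
  shows "(\<Prod>v\<in>Poly_Mapping.keys (m + k). x v ^ Poly_Mapping.lookup (m + k) v) =
    (\<Prod>v\<in>Poly_Mapping.keys m. x v ^ Poly_Mapping.lookup m v) *
    (\<Prod>v\<in>Poly_Mapping.keys k. x v ^ Poly_Mapping.lookup k v)"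
proof -
  have *: "(\<Prod>v\<in>Poly_Mapping.keys l. x v ^ Poly_Mapping.lookup l v) =
      (\<Prod>v\<in>A. x v ^ Poly_Mapping.lookup l v)"
    if "finite A" "Poly_Mapping.keys l \<subseteq> A" for l :: "'v \<Rightarrow>\<^sub>0 nat" and A
    by (rule prod.mono_neutral_left) (use that in \<open>auto simp: in_keys_iff\<close>)
  let ?A = "Poly_Mapping.keys m \<union> Poly_Mapping.keys k"
  have "Poly_Mapping.keys (m + k) \<subseteq> ?A"
    by (rule Poly_Mapping.keys_add)
  then show ?thesis
    using *[of ?A m] *[of ?A k] *[of ?A "m + k"]
    by (simp add: lookup_add power_add prod.distrib)
qed

lemma mpoly_sum_single:
  "(p :: ('v, 'l::field) mpoly) =
     (\<Sum>m\<in>Poly_Mapping.keys p. Poly_Mapping.single m (Poly_Mapping.lookup p m))"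
proof (rule poly_mapping_eqI)
  fix k
  show "Poly_Mapping.lookup p k = Poly_Mapping.lookup
     (\<Sum>m\<in>Poly_Mapping.keys p. Poly_Mapping.single m (Poly_Mapping.lookup p m)) k"
    by (auto simp: lookup_sum lookup_single when_def in_keys_iff)
qed

lemma peval_mult: "peval (p * q) x = peval p x * peval q x"
proof -
  have "p * q = (\<Sum>m\<in>Poly_Mapping.keys p. \<Sum>k\<in>Poly_Mapping.keys q.
      Poly_Mapping.single (m + k) (Poly_Mapping.lookup p m * Poly_Mapping.lookup q k))"
    by (subst mpoly_sum_single[of p], subst mpoly_sum_single[of q])
       (simp add: sum_product mult_single)
  then have "peval (p * q) x =
      (\<Sum>m\<in>Poly_Mapping.keys p. \<Sum>k\<in>Poly_Mapping.keys q.
        (to_ac (Poly_Mapping.lookup p m) *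
          (\<Prod>v\<in>Poly_Mapping.keys m. x v ^ Poly_Mapping.lookup m v)) *
        (to_ac (Poly_Mapping.lookup q k) *
          (\<Prod>v\<in>Poly_Mapping.keys k. x v ^ Poly_Mapping.lookup k v)))"
    by (simp add: peval_sum peval_single monomial_eval_add mult_ac)
  then show ?thesis
    by (simp add: peval_def sum_product)
qed

subsection \<open>Zariski topology and morphisms over the ground field\<close>

text \<open>
  An affine \<open>L\<close>-variety is given by a set \<open>X\<close> of points over the algebraic closure and a map
  \<open>c\<close> sending a point to its family of affine coordinates. Closed sets are the common zero
  sets of polynomials over \<open>L\<close> (not over its closure), so the lattice of closed sets is that of
  the \<open>L\<close>-scheme: in particular connected components and density are those of the \<open>L\<close>-scheme.
\<close>

definition zariski_open ::
  "('a \<Rightarrow> 'v \<Rightarrow> 'l::field alg_closure) \<Rightarrow> 'a set \<Rightarrow> 'a set \<Rightarrow> bool" where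
  "zariski_open c X U \<longleftrightarrow>
     (\<exists>P :: ('v, 'l) mpoly set. U = X - {x \<in> X. \<forall>p\<in>P. peval p (c x) = 0})"

definition zariski :: "('a \<Rightarrow> 'v \<Rightarrow> 'l::field alg_closure) \<Rightarrow> 'a set \<Rightarrow> 'a topology" where
  "zariski c X = topology (zariski_open c X)"

lemma zariski_open_iff:
  fixes c :: "'a \<Rightarrow> 'v \<Rightarrow> 'l::field alg_closure"
  shows "zariski_open c X U \<longleftrightarrow> (\<exists>P :: ('v, 'l) mpoly set.
    \<forall>x. x \<in> U \<longleftrightarrow> x \<in> X \<and> (\<exists>p\<in>P. peval p (c x) \<noteq> 0))"
proof -
  have "U = X - {x \<in> X. \<forall>p\<in>P. peval p (c x) = 0} \<longleftrightarrow>
      (\<forall>x. x \<in> U \<longleftrightarrow> x \<in> X \<and> (\<exists>p\<in>P. peval p (c x) \<noteq> 0))"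
    for P :: "('v, 'l) mpoly set"
    unfolding set_eq_iff by simp blast
  then show ?thesis
    unfolding zariski_open_def by simp
qed

lemma istopology_zariski_open:
  fixes c :: "'a \<Rightarrow> 'v \<Rightarrow> 'l::field alg_closure"
  shows "istopology (zariski_open c X)"
  unfolding istopology_def
proof (intro conjI allI impI)
  fix U V assume UV: "zariski_open c X U" "zariski_open c X V"
  from UV(1) obtain P :: "('v, 'l) mpoly set"
    where U: "\<forall>x. x \<in> U \<longleftrightarrow> x \<in> X \<and> (\<exists>p\<in>P. peval p (c x) \<noteq> 0)"
    unfolding zariski_open_iff by (rule exE)
  from UV(2) obtain Q :: "('v, 'l) mpoly set"
    where V: "\<forall>x. x \<in> V \<longleftrightarrow> x \<in> X \<and> (\<exists>q\<in>Q. peval q (c x) \<noteq> 0)"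
    unfolding zariski_open_iff by (rule exE)
  have "\<forall>x. x \<in> U \<inter> V \<longleftrightarrow> x \<in> X \<and>
      (\<exists>r \<in> (\<lambda>(p, q). p * q) ` (P \<times> Q). peval r (c x) \<noteq> 0)"
    by (auto simp: U V peval_mult)
  then show "zariski_open c X (U \<inter> V)"
    unfolding zariski_open_iff by (rule exI)
next
  fix \<K> assume "\<forall>K\<in>\<K>. zariski_open c X K"
  then have "\<forall>K\<in>\<K>. \<exists>P :: ('v, 'l) mpoly set.
      \<forall>x. x \<in> K \<longleftrightarrow> x \<in> X \<and> (\<exists>p\<in>P. peval p (c x) \<noteq> 0)"
    unfolding zariski_open_iff .
  from bchoice[OF this] obtain P :: "'a set \<Rightarrow> ('v, 'l) mpoly set"
    where P: "\<forall>K\<in>\<K>. \<forall>x. x \<in> K \<longleftrightarrow> x \<in> X \<and> (\<exists>p\<in>P K. peval p (c x) \<noteq> 0)"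
    by (rule exE)
  have "\<forall>x. x \<in> \<Union>\<K> \<longleftrightarrow> x \<in> X \<and> (\<exists>p \<in> (\<Union>K\<in>\<K>. P K). peval p (c x) \<noteq> 0)"
    using P by auto
  then show "zariski_open c X (\<Union>\<K>)"
    unfolding zariski_open_iff by (rule exI)
qed

lemma openin_zariski: "openin (zariski c X) = zariski_open c X"
  by (simp add: zariski_def istopology_zariski_open)

lemma topspace_zariski [simp]: "topspace (zariski c X) = X"
proof -
  have "X = X - {x \<in> X. \<forall>p\<in>{1}. peval p (c x) = 0}"
    by auto
  then have "zariski_open c X X"
    unfolding zariski_open_def by (rule exI)
  moreover have "U \<subseteq> X" if "zariski_open c X U" for U
    using that unfolding zariski_open_def by blast
  ultimately show ?thesis
    unfolding topspace_def openin_zariski by (intro equalityI Sup_least Sup_upper) auto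
qed

lemma closedin_zariski:
  fixes c :: "'a \<Rightarrow> 'v \<Rightarrow> 'l::field alg_closure"
  shows "closedin (zariski c X) Z \<longleftrightarrow>
    (\<exists>P :: ('v, 'l) mpoly set. Z = {x \<in> X. \<forall>p\<in>P. peval p (c x) = 0})"
proof -
  have *: "Z \<subseteq> X \<and> X - Z = X - W \<longleftrightarrow> Z = W" if "W \<subseteq> X" for W
    using that by blast
  have "closedin (zariski c X) Z \<longleftrightarrow> Z \<subseteq> X \<and> zariski_open c X (X - Z)"
    by (simp add: closedin_def openin_zariski)
  also have "\<dots> \<longleftrightarrow> (\<exists>P :: ('v, 'l) mpoly set.
      Z \<subseteq> X \<and> X - Z = X - {x \<in> X. \<forall>p\<in>P. peval p (c x) = 0})"
    unfolding zariski_open_def by (simp only: ex_simps)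
  also have "\<dots> \<longleftrightarrow> (\<exists>P :: ('v, 'l) mpoly set. Z = {x \<in> X. \<forall>p\<in>P. peval p (c x) = 0})"
    by (subst *) auto
  finally show ?thesis .
qed

definition regular_function ::
  "('a \<Rightarrow> 'v \<Rightarrow> 'l::field alg_closure) \<Rightarrow> 'a set \<Rightarrow> ('a \<Rightarrow> 'l alg_closure) \<Rightarrow> bool" where
  "regular_function c X h \<longleftrightarrow> (\<exists>p :: ('v, 'l) mpoly. \<forall>x\<in>X. h x = peval p (c x))"

definition variety_morphism ::
  "('a \<Rightarrow> 'v \<Rightarrow> 'l::field alg_closure) \<Rightarrow> 'a set \<Rightarrow>
   ('b \<Rightarrow> 'w \<Rightarrow> 'l alg_closure) \<Rightarrow> 'b set \<Rightarrow> ('a \<Rightarrow> 'b) \<Rightarrow> bool" where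
  "variety_morphism c X d Y f \<longleftrightarrow>
     f \<in> X \<rightarrow> Y \<and> (\<forall>w. regular_function c X (\<lambda>x. d (f x) w))"

definition algebraic_group_iso ::
  "('a \<Rightarrow> 'v \<Rightarrow> 'l::field alg_closure) \<Rightarrow> 'a monoid \<Rightarrow>
   ('b \<Rightarrow> 'w \<Rightarrow> 'l alg_closure) \<Rightarrow> 'b monoid \<Rightarrow> ('a \<Rightarrow> 'b) \<Rightarrow> bool" where
  "algebraic_group_iso c A d B f \<longleftrightarrow>
     f \<in> iso A B \<and>
     variety_morphism c (carrier A) d (carrier B) f \<and>
     variety_morphism d (carrier B) c (carrier A) (inv_into (carrier A) f)"

subsection \<open>Linear algebraic groups\<close>

definition GL :: "('k::field ^ 'm::finite ^ 'm) monoid" where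
  "GL = \<lparr>carrier = {A. invertible A}, monoid.mult = (**), one = mat 1\<rparr>"

abbreviation GL_on :: "('k::field ^ 'm::finite ^ 'm) set \<Rightarrow> ('k ^ 'm ^ 'm) monoid" where
  "GL_on H \<equiv> GL\<lparr>carrier := H\<rparr>"

text \<open>\<open>GL_m\<close> is affine via the matrix entries and the inverse of the determinant.\<close>

fun GL_coord :: "'k::field ^ 'm::finite ^ 'm \<Rightarrow> ('m \<times> 'm) option \<Rightarrow> 'k" where
  "GL_coord A None = inverse (det A)"
| "GL_coord A (Some (i, j)) = A $ i $ j"

definition linear_algebraic_group :: "('l::field alg_closure ^ 'm::finite ^ 'm) set \<Rightarrow> bool" where
  "linear_algebraic_group T \<longleftrightarrow> subgroup T GL \<and> closedin (zariski GL_coord (carrier GL)) T"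

text \<open>The induced topology on a subset of \<open>GL_m\<close>; see \<open>subtopology_zariski_GL\<close> below.\<close>

definition zariski_GL ::
  "('l::field alg_closure ^ 'm::finite ^ 'm) set \<Rightarrow> ('l alg_closure ^ 'm ^ 'm) topology" where
  "zariski_GL T = zariski GL_coord T"

lemma subtopology_zariski:
  assumes "Y \<subseteq> X"
  shows "subtopology (zariski c X) Y = zariski c Y"
proof (rule topology_eq[THEN iffD2], intro allI)
  fix U
  show "openin (subtopology (zariski c X) Y) U \<longleftrightarrow> openin (zariski c Y) U"
  proof
    assume "openin (subtopology (zariski c X) Y) U"
    then obtain P where "U = (X - {x \<in> X. \<forall>p\<in>P. peval p (c x) = 0}) \<inter> Y"
      unfolding openin_subtopology openin_zariski zariski_open_def by blast
    then have "U = Y - {x \<in> Y. \<forall>p\<in>P. peval p (c x) = 0}"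
      using assms by blast
    then show "openin (zariski c Y) U"
      unfolding openin_zariski zariski_open_def by blast
  next
    assume "openin (zariski c Y) U"
    then obtain P where "U = Y - {x \<in> Y. \<forall>p\<in>P. peval p (c x) = 0}"
      unfolding openin_zariski zariski_open_def by blast
    then have "U = (X - {x \<in> X. \<forall>p\<in>P. peval p (c x) = 0}) \<inter> Y"
      using assms by blast
    then show "openin (subtopology (zariski c X) Y) U"
      unfolding openin_subtopology openin_zariski zariski_open_def by blast
  qed
qed

lemma subtopology_zariski_GL: "Y \<subseteq> X \<Longrightarrow> subtopology (zariski_GL X) Y = zariski_GL Y"
  by (simp add: zariski_GL_def subtopology_zariski)

definition identity_component ::
  "('l::field alg_closure ^ 'm::finite ^ 'm) set \<Rightarrow> ('l alg_closure ^ 'm ^ 'm) set" where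
  "identity_component T = connected_component_of_set (zariski_GL T) (mat 1)"

definition rational_points ::
  "('l::field alg_closure ^ 'm::finite ^ 'm) set \<Rightarrow> ('l alg_closure ^ 'm ^ 'm) set" where
  "rational_points T = {A \<in> T. \<forall>i j. A $ i $ j \<in> range to_ac}"

definition zariski_dense ::
  "('l::field alg_closure ^ 'm::finite ^ 'm) set \<Rightarrow> ('l alg_closure ^ 'm ^ 'm) set \<Rightarrow> bool" where
  "zariski_dense S T \<longleftrightarrow> S \<subseteq> T \<and> zariski_GL T closure_of S = T"

subsection \<open>The group \<open>G_m^r \<times> G_a^n\<close>\<close>

definition Gm :: "'k::field monoid" where
  "Gm = \<lparr>carrier = - {0}, monoid.mult = (*), one = 1\<rparr>"

definition Ga :: "'k::field monoid" where
  "Ga = \<lparr>carrier = UNIV, monoid.mult = (+), one = 0\<rparr>"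

definition Gm_Ga :: "nat \<Rightarrow> nat \<Rightarrow> ((nat \<Rightarrow> 'k::field) \<times> (nat \<Rightarrow> 'k)) monoid" where
  "Gm_Ga r n = product_group {..<r} (\<lambda>_. Gm) \<times>\<times> product_group {..<n} (\<lambda>_. Ga)"

datatype Gm_Ga_var = Mul nat | Mul_Inv nat | Add nat

text \<open>
  The affine coordinates are \<open>x_i\<close>, \<open>x_i^{-1}\<close> (\<open>i < r\<close>) and \<open>y_j\<close> (\<open>j < n\<close>); the coordinates
  beyond these ranges are set to \<open>0\<close>, since the extensional functions in the carrier
  take the value \<open>undefined\<close> there.
\<close>

fun Gm_Ga_coord ::
  "nat \<Rightarrow> nat \<Rightarrow> (nat \<Rightarrow> 'k::field) \<times> (nat \<Rightarrow> 'k) \<Rightarrow> Gm_Ga_var \<Rightarrow> 'k" where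
  "Gm_Ga_coord r n (x, y) (Mul i) = (if i < r then x i else 0)"
| "Gm_Ga_coord r n (x, y) (Mul_Inv i) = (if i < r then inverse (x i) else 0)"
| "Gm_Ga_coord r n (x, y) (Add j) = (if j < n then y j else 0)"

definition isomorphic_to_Gm_Ga ::
  "('l::field alg_closure ^ 'm::finite ^ 'm) set \<Rightarrow> nat \<Rightarrow> nat \<Rightarrow> bool" where
  "isomorphic_to_Gm_Ga H r n \<longleftrightarrow>
     (\<exists>f. algebraic_group_iso GL_coord (GL_on H) (Gm_Ga_coord r n) (Gm_Ga r n) f)"

end

theory Submission
  imports Defs "HOL-Number_Theory.Cong"
begin

no_notation fps_nth (infixl \<open>$\<close> 75)

text \<open>
  Let \<open>g\<close> generate \<open>G\<close>. The key is the Skolem-Mahler-Lech theorem: there is \<open>M \<ge> 1\<close>,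
  depending only on \<open>g\<close>, such that a polynomial function on \<open>GL_m\<close> vanishing at
  infinitely many powers of \<open>h = g^M\<close> vanishes at all of them. Following Hansel, no completion
  is needed. The entries of \<open>g\<close> and of its inverse lie in a ring \<open>R\<close> that behaves like a subring of
  the \<open>p\<close>-adic integers and in which they have finitely many residues mod \<open>p\<^sup>2\<close>; so some \<open>h = g^M\<close> is
  congruent to 1 mod \<open>p\<^sup>2\<close>, and by the binomial series the entries of \<open>h^l\<close> are, on each initial
  segment, polynomials over \<open>R\<close> in \<open>p l\<close>. Each zero of such a polynomial contributes
  a factor \<open>p\<close> to all of its values.

  Consequently the closure \<open>D\<close> of the group generated by \<open>h\<close> is connected. It is a subgroup with
  \<open>T\<close> the union of the finitely many translates of \<open>D\<close> by powers of \<open>g\<close>, so it is open and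
  closed and equals the identity component. An infinite subset \<open>S\<close> of a component meets some
  coset \<open>g^k D\<close> infinitely often, so every function vanishing on \<open>S\<close> vanishes on \<open>g^k D\<close>, which is
  the component. Finally, if there were two additive coordinates \<open>y_0, y_1\<close>, the function
  \<open>y_1(h) y_0 - y_0(h) y_1\<close> would vanish on the powers of \<open>h\<close>, hence on \<open>D\<close>.
\<close>

subsection \<open>Polynomials over a subring\<close>

text \<open>Subrings are carrier sets inside one type, so that the successive rings and fields built
  below can be compared by inclusion. Closure under \<open>-\<close> yields 0, negatives and
  sums.\<close>

definition subring_set :: "'a::comm_ring_1 set \<Rightarrow> bool" where
  "subring_set R \<longleftrightarrow> 1 \<in> R \<and> (\<forall>x\<in>R. \<forall>y\<in>R. x - y \<in> R \<and> x * y \<in> R)"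

lemma subring_setI:
  "1 \<in> R \<Longrightarrow> (\<And>x y. x \<in> R \<Longrightarrow> y \<in> R \<Longrightarrow> x - y \<in> R) \<Longrightarrow>
   (\<And>x y. x \<in> R \<Longrightarrow> y \<in> R \<Longrightarrow> x * y \<in> R) \<Longrightarrow> subring_set R"
  by (auto simp: subring_set_def)

context
  fixes R :: "'a::comm_ring_1 set"
  assumes R: "subring_set R"
begin

lemma subring_one: "1 \<in> R"
  using R by (auto simp: subring_set_def)

lemma subring_diff: "x \<in> R \<Longrightarrow> y \<in> R \<Longrightarrow> x - y \<in> R"
  using R by (auto simp: subring_set_def)

lemma subring_mult: "x \<in> R \<Longrightarrow> y \<in> R \<Longrightarrow> x * y \<in> R"
  using R by (auto simp: subring_set_def)

lemma subring_zero: "0 \<in> R"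
  using subring_diff[OF subring_one subring_one] by simp

lemma subring_uminus: "x \<in> R \<Longrightarrow> - x \<in> R"
  using subring_diff[OF subring_zero] by fastforce

lemma subring_add: "x \<in> R \<Longrightarrow> y \<in> R \<Longrightarrow> x + y \<in> R"
  using subring_diff[of x "- y"] subring_uminus by simp

lemma subring_power: "x \<in> R \<Longrightarrow> x ^ k \<in> R"
  by (induction k) (auto intro: subring_one subring_mult)

lemma subring_of_nat: "of_nat k \<in> R"
  by (induction k) (auto intro: subring_zero subring_one subring_add)

lemma subring_of_int: "of_int k \<in> R"
  by (cases k rule: int_cases2) (auto intro: subring_of_nat subring_uminus)

lemma subring_sum: "(\<And>i. i \<in> I \<Longrightarrow> f i \<in> R) \<Longrightarrow> sum f I \<in> R"
  by (induction I rule: infinite_finite_induct) (auto intro: subring_zero subring_add)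

lemma subring_prod: "(\<And>i. i \<in> I \<Longrightarrow> f i \<in> R) \<Longrightarrow> prod f I \<in> R"
  by (induction I rule: infinite_finite_induct) (auto intro: subring_one subring_mult)

lemmas subring_closed = subring_one subring_zero subring_diff subring_mult subring_uminus
  subring_add subring_power subring_of_nat subring_of_int subring_sum subring_prod

end

definition polys :: "'a::zero set \<Rightarrow> 'a poly set" where
  "polys R = {p. \<forall>i. Polynomial.coeff p i \<in> R}"

lemma polysD: "p \<in> polys R \<Longrightarrow> Polynomial.coeff p i \<in> R"
  by (simp add: polys_def)

lemma polys_mono: "R \<subseteq> R' \<Longrightarrow> polys R \<subseteq> polys R'"
  by (auto simp: polys_def)

lemma polys_pCons_iff: "pCons a p \<in> polys R \<longleftrightarrow> a \<in> R \<and> p \<in> polys R"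
  by (auto simp: polys_def coeff_pCons split: nat.splits)

context
  fixes R :: "'a::comm_ring_1 set"
  assumes R: "subring_set R"
begin

lemma polys_0: "0 \<in> polys R"
  by (auto simp: polys_def subring_zero[OF R])

lemma polys_pCons: "a \<in> R \<Longrightarrow> p \<in> polys R \<Longrightarrow> pCons a p \<in> polys R"
  by (simp add: polys_pCons_iff)

lemma polys_const: "a \<in> R \<Longrightarrow> [:a:] \<in> polys R"
  by (intro polys_pCons polys_0)

lemma polys_smult: "a \<in> R \<Longrightarrow> p \<in> polys R \<Longrightarrow> Polynomial.smult a p \<in> polys R"
  by (auto simp: polys_def subring_mult[OF R])

lemma subring_polys: "subring_set (polys R)"
proof (rule subring_setI)
  show "1 \<in> polys R"
    using polys_const[OF subring_one[OF R]] by (simp add: one_pCons)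
next
  fix p q assume pq: "p \<in> polys R" "q \<in> polys R"
  then show "p - q \<in> polys R"
    by (auto simp: polys_def subring_diff[OF R])
  from pq show "p * q \<in> polys R"
    by (auto simp: polys_def coeff_mult intro!: subring_sum[OF R] subring_mult[OF R])
qed

lemmas polys_closed = polys_0 polys_pCons polys_const polys_smult
  subring_closed[OF subring_polys]

lemma poly_in_subring:
  assumes "p \<in> polys R" "x \<in> R"
  shows "poly p x \<in> R"
  using assms(1)
  by (induction p) (auto simp: polys_pCons_iff subring_zero[OF R]
      intro!: subring_add[OF R] subring_mult[OF R] assms(2))

lemma synthetic_div_in_polys:
  assumes "p \<in> polys R" "c \<in> R"
  shows "synthetic_div p c \<in> polys R"
  using assms(1)
  by (induction p) (auto simp: polys_pCons_iff polys_0 synthetic_div_pCons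
      intro!: poly_in_subring assms(2))

text \<open>Horner's scheme carries the congruence modulo \<open>e\<close> through one coefficient
  at a time. With \<open>e = \<pi>^2\<close> it compares values at \<open>t\<close> and at
  \<open>c\<close> when a transcendental element is adjoined.\<close>

lemma poly_shift_cong:
  assumes "p \<in> polys R" "a \<in> R" "b \<in> R" "e \<in> R"
  shows "\<exists>y\<in>R. poly p (a + e * b) = poly p a + e * y"
  using assms(1)
proof (induction p)
  case 0
  then show ?case using subring_zero[OF R] by (intro bexI[of _ 0]) auto
next
  case (pCons c p)
  then obtain y where y: "y \<in> R" "poly p (a + e * b) = poly p a + e * y"
    by (auto simp: polys_pCons_iff)
  have p: "poly p a \<in> R"
    using pCons.prems poly_in_subring[OF _ assms(2)] by (auto simp: polys_pCons_iff)
  have "a * y + b * (poly p a + e * y) \<in> R"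
    by (intro subring_add[OF R] subring_mult[OF R] assms y p)
  moreover have "poly (pCons c p) (a + e * b) =
      poly (pCons c p) a + e * (a * y + b * (poly p a + e * y))"
    unfolding poly_pCons y(2) by (simp add: algebra_simps)
  ultimately show ?case by blast
qed

text \<open>Division by a monic polynomial inverts nothing, so the coefficients never leave
  \<open>R\<close>.\<close>

lemma monic_division:
  assumes m: "m \<in> polys R" "Polynomial.lead_coeff m = 1" "Polynomial.degree m > 0"
    and "f \<in> polys R"
  shows "\<exists>q\<in>polys R. \<exists>r\<in>polys R. f = q * m + r \<and> Polynomial.degree r < Polynomial.degree m"
  using assms(4)
proof (induction f)
  case 0
  then show ?case using polys_0 m(3) by (intro bexI[of _ 0]) auto
next
  case (pCons a f)
  then obtain q r where qr: "q \<in> polys R" "r \<in> polys R" "f = q * m + r"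
    "Polynomial.degree r < Polynomial.degree m"
    by (auto simp: polys_pCons_iff)
  have a: "a \<in> R" using pCons.prems by (simp add: polys_pCons_iff)
  \<comment> \<open>\<open>pCons a r\<close> is \<open>a\<close> plus the variable times
    \<open>r\<close>. Its degree is at most that of \<open>m\<close>, and \<open>c\<close> is the
    coefficient that a multiple of \<open>m\<close> has to cancel.\<close>
  define c where "c = Polynomial.coeff (pCons a r) (Polynomial.degree m)"
  define r' where "r' = pCons a r - Polynomial.smult c m"
  have c: "c \<in> R"
    unfolding c_def using polys_pCons[OF a qr(2)] by (rule polysD)
  have "r' \<in> polys R"
    unfolding r'_def using a qr m c by (intro polys_closed)
  moreover have "pCons 0 q + [:c:] \<in> polys R"
    using qr c subring_zero[OF R] by (intro polys_closed)
  moreover have "pCons a f = (pCons 0 q + [:c:]) * m + r'"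
    by (simp add: r'_def qr(3) algebra_simps)
  moreover have "Polynomial.degree r' < Polynomial.degree m"
  proof -
    have "Polynomial.degree (pCons a r) \<le> Polynomial.degree m"
      using qr(4) by (simp add: degree_pCons_eq_if)
    then have "Polynomial.degree r' \<le> Polynomial.degree m"
      unfolding r'_def by (intro degree_diff_le degree_smult_le)
    moreover have "Polynomial.coeff r' (Polynomial.degree m) = 0"
      using m(2) by (simp add: r'_def c_def)
    ultimately show ?thesis
      using m(3) by (metis le_neq_implies_less leading_coeff_0_iff degree_0)
  qed
  ultimately show ?case by blast
qed

end

subsection \<open>Adic models of finitely generated fields\<close>

definition subfield_set :: "'a::field set \<Rightarrow> bool" where
  "subfield_set F \<longleftrightarrow> subring_set F \<and> (\<forall>x\<in>F. inverse x \<in> F)"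

lemma subfield_ring: "subfield_set F \<Longrightarrow> subring_set F"
  by (simp add: subfield_set_def)

lemma subfield_inverse: "subfield_set F \<Longrightarrow> x \<in> F \<Longrightarrow> inverse x \<in> F"
  by (simp add: subfield_set_def)

lemma subfield_divide: "subfield_set F \<Longrightarrow> x \<in> F \<Longrightarrow> y \<in> F \<Longrightarrow> x / y \<in> F"
  by (simp add: divide_inverse subfield_inverse subring_mult[OF subfield_ring])

text \<open>
  A substitute for an embedding into the \<open>p\<close>-adic integers, with \<open>\<pi>\<close> in the role of \<open>p\<close>.
  Finiteness modulo \<open>\<pi>\<^sup>2\<close> is only required of \<open>A\<close>: a transcendental extension adjoins
  to \<open>R\<close> a free variable, which has infinitely many residues.
\<close>

definition padic_model :: "'a::field_char_0 \<Rightarrow> 'a set \<Rightarrow> 'a set \<Rightarrow> bool" where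
  "padic_model \<pi> R A \<longleftrightarrow> subring_set R \<and> subring_set A \<and> A \<subseteq> R \<and> \<pi> \<in> R \<and> \<pi> \<noteq> 0 \<and>
     (\<forall>y\<in>R. \<pi>\<^sup>2 * y \<in> A) \<and>
     (\<exists>Q. finite Q \<and> (\<forall>a\<in>A. \<exists>q\<in>Q. \<exists>y\<in>R. a = q + \<pi>\<^sup>2 * y)) \<and>
     (\<forall>x. (\<forall>k. \<exists>y\<in>R. x = \<pi> ^ k * y) \<longrightarrow> x = 0) \<and>
     (\<forall>j. \<pi> ^ j / fact j \<in> R)"

text \<open>The model has to lie inside \<open>F\<close>: polynomials over \<open>R\<close> are then
  polynomials over \<open>F\<close>, so transcendence over \<open>F\<close>, or minimality of a
  polynomial over \<open>F\<close>, makes coefficients over \<open>R\<close> unique.\<close>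

definition padic_field :: "'a::field_char_0 set \<Rightarrow> bool" where
  "padic_field F \<longleftrightarrow> subfield_set F \<and>
     (\<forall>S. finite S \<and> S \<subseteq> F \<longrightarrow> (\<exists>\<pi> R A. padic_model \<pi> R A \<and> S \<subseteq> A \<and> R \<subseteq> F))"

section \<open>Base case: the rationals and the localization of the integers at a prime\<close>

lemma fact_dvd_prime_power:
  fixes p :: nat
  assumes "Factorial_Ring.prime p"
  shows "\<exists>q. \<not> p dvd q \<and> fact j dvd p ^ j * q"
proof (induction j rule: less_induct)
  case (less j)
  show ?case
  proof (cases "j = 0")
    case True
    have "\<not> p dvd 1" using assms not_prime_unit by auto
    with True show ?thesis by (intro exI[of _ 1]) auto
  next
    case False
    \<comment> \<open>The multiples of \<open>p\<close> up to \<open>j\<close> contribute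
      \<open>p ^ m * fact m\<close> to the factorial. By induction \<open>fact m\<close> accounts
      for at most \<open>m\<close> further factors \<open>p\<close>, and
      \<open>2 * m \<le> j\<close> holds even for \<open>p = 2\<close>.\<close>
    define m where "m = j div p"
    have p2: "p \<ge> 2" using assms prime_ge_2_nat by blast
    have "m < j" using False p2 by (simp add: m_def)
    with less obtain q where q: "\<not> p dvd q" "fact m dvd p ^ m * q" by blast
    have jm: "2 * m \<le> j"
      using p2 div_le_mono2[of 2 p j] by (simp add: m_def)
    define N where "N = \<Prod>{i \<in> {1..j}. \<not> p dvd i}"
    have N: "\<not> p dvd N"
      unfolding N_def using assms by (subst prime_dvd_prod_iff) auto
    have "{i \<in> {1..j}. p dvd i} = (\<lambda>i. p * i) ` {1..m}"
    proof -
      have "i \<in> (\<lambda>i. p * i) ` {1..m}" if i: "i \<in> {1..j}" "p dvd i" for i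
      proof -
        from i(2) obtain c where c: "i = p * c" by blast
        then have "c \<le> m" using i(1) p2 by (simp add: m_def less_eq_div_iff_mult_less_eq mult.commute)
        moreover have "c \<ge> 1" using c i(1) by (cases c) auto
        ultimately show ?thesis using c by auto
      qed
      moreover have "p * i \<le> j" if "i \<le> m" for i
        using that p2 by (simp add: m_def less_eq_div_iff_mult_less_eq mult.commute)
      ultimately show ?thesis using p2 by (auto 0 3 simp: Suc_le_eq)
    qed
    then have M: "\<Prod>{i \<in> {1..j}. p dvd i} = p ^ m * fact m"
      using p2 by (simp add: prod.reindex inj_on_def fact_prod prod.distrib)
    have "fact j = \<Prod>{i \<in> {1..j}. p dvd i} * N"
    proof -
      have "fact j = \<Prod>({i \<in> {1..j}. p dvd i} \<union> {i \<in> {1..j}. \<not> p dvd i})"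
        unfolding fact_prod by (simp add: Un_def) (rule prod.cong; auto)
      also have "\<dots> = \<Prod>{i \<in> {1..j}. p dvd i} * N"
        unfolding N_def by (rule prod.union_disjoint) auto
      finally show ?thesis .
    qed
    also have "\<dots> = p ^ m * fact m * N" by (simp only: M)
    also have "\<dots> dvd p ^ m * (p ^ m * q) * N"
      by (intro mult_dvd_mono q dvd_refl)
    also have "\<dots> = p ^ (2 * m) * (q * N)"
      by (simp add: mult_2 power_add)
    also have "\<dots> dvd p ^ j * (q * N)"
      by (intro mult_dvd_mono le_imp_power_dvd jm dvd_refl)
    finally have "fact j dvd p ^ j * (q * N)" .
    moreover have "\<not> p dvd q * N"
      using N q(1) assms by (simp add: prime_dvd_mult_iff)
    ultimately show ?thesis by blast
  qed
qed

lemma common_denominator: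
  assumes "finite S" "S \<subseteq> (\<rat> :: 'a::field_char_0 set)"
  shows "\<exists>d::nat. d > 0 \<and> (\<forall>s\<in>S. \<exists>a::int. s = of_int a / of_nat d)"
  using assms
proof (induction S rule: finite_induct)
  case empty
  then show ?case by (intro exI[of _ 1]) auto
next
  case (insert x S)
  then obtain d where d: "d > 0" "\<forall>s\<in>S. \<exists>a::int. s = of_int a / (of_nat d :: 'a)" by auto
  from insert.prems have "x \<in> \<rat>" by auto
  then obtain a b where ab: "b > 0" "x = of_int a / of_int b"
    by (rule Rats_cases') auto
  define e where "e = nat b"
  have e: "e > 0" "x = of_int a / of_nat e" using ab by (auto simp: e_def)
  have "\<exists>a::int. s = of_int a / of_nat (d * e)" if s: "s \<in> insert x S" for s
  proof (cases "s = x")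
    case True
    then have "s = of_int (a * int d) / of_nat (d * e)" using e d(1) by (simp add: field_simps)
    then show ?thesis by blast
  next
    case False
    with s d(2) obtain c where "s = of_int c / of_nat d" by auto
    then have "s = of_int (c * int e) / of_nat (d * e)" using e d(1) by (simp add: field_simps)
    then show ?thesis by blast
  qed
  then show ?case using d(1) e(1) by (intro exI[of _ "d * e"]) simp
qed

text \<open>Here \<open>R\<close> is the localization of the integers at \<open>p\<close>. Its
  denominators are invertible modulo \<open>p^2\<close>, so its residues are those of the integers
  and \<open>A\<close> may be all of \<open>R\<close>. The bound on the power of \<open>p\<close> in
  a factorial puts \<open>p ^ j / fact j\<close> into \<open>R\<close>.\<close>

lemma padic_model_localization:
  fixes p :: nat
  assumes "Factorial_Ring.prime p"
  defines "R \<equiv> {of_int a / of_int b | a b. \<not> int p dvd b} :: 'a::field_char_0 set"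
  shows "padic_model (of_nat p) R R"
proof -
  have pp: "Factorial_Ring.prime (int p)" using assms by simp
  have p1: "p > 1" using assms prime_gt_1_nat by blast
  have RI: "of_int a / of_int b \<in> R" if "\<not> int p dvd b" for a b
    unfolding R_def using that by blast
  have RE: "\<exists>a b. x = of_int a / of_int b \<and> \<not> int p dvd b \<and> b \<noteq> 0" if "x \<in> R" for x
    using that unfolding R_def by fastforce
  have RI1: "of_int a \<in> R" for a
    using RI[of 1 a] p1 by (simp add: zdvd_not_zless)
  have ring: "subring_set R"
  proof (rule subring_setI)
    show "1 \<in> R" using RI1[of 1] by simp
  next
    fix x y assume "x \<in> R" "y \<in> R"
    then obtain a b c d where *: "x = of_int a / of_int b" "\<not> int p dvd b" "b \<noteq> 0"
      "y = of_int c / of_int d" "\<not> int p dvd d" "d \<noteq> 0" using RE by meson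
    then have bd: "\<not> int p dvd b * d" using pp by (simp add: prime_dvd_mult_iff)
    have "x - y = of_int (a * d - c * b) / of_int (b * d)"
      using *(3,6) unfolding *(1,4) by (simp add: field_simps)
    then show "x - y \<in> R" by (simp only: RI[OF bd])
    have "x * y = of_int (a * c) / of_int (b * d)" using * by simp
    then show "x * y \<in> R" by (simp only: RI[OF bd])
  qed
  have fin: "\<exists>q\<in>of_int ` {0..<(int p)\<^sup>2}. \<exists>y\<in>R. x = q + (of_nat p)\<^sup>2 * y" if "x \<in> R" for x
  proof -
    from RE[OF that] obtain a b where ab: "x = of_int a / of_int b" "\<not> int p dvd b" "b \<noteq> 0" by blast
    then have "coprime (int p) b"
      using pp by (simp add: prime_imp_coprime)
    then have "coprime b ((int p)\<^sup>2)"
      by (simp add: coprime_commute)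
    then obtain b' where b': "[b * b' = 1] (mod (int p)\<^sup>2)"
      using cong_solve_coprime_int by blast
    define q where "q = (a * b') mod (int p)\<^sup>2"
    have "[q * b = a * (b * b')] (mod (int p)\<^sup>2)"
      unfolding q_def cong_def by (simp add: mod_simps mult_ac)
    also have "[a * (b * b') = a * 1] (mod (int p)\<^sup>2)"
      using b' by (rule cong_scalar_left)
    finally have "(int p)\<^sup>2 dvd a - q * b"
      by (simp add: cong_iff_dvd_diff dvd_diff_commute)
    then obtain c where c: "a - q * b = (int p)\<^sup>2 * c" by blast
    then have "a = q * b + (int p)\<^sup>2 * c" by simp
    then have "x = of_int q + (of_nat p)\<^sup>2 * (of_int c / of_int b)"
      using ab by (simp add: field_simps)
    moreover have "q \<in> {0..<(int p)\<^sup>2}" unfolding q_def using p1 by simp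
    ultimately show ?thesis using RI[OF ab(2)] by blast
  qed
  have sep: "x = 0" if x: "\<forall>k. \<exists>y\<in>R. x = of_nat p ^ k * y" for x :: 'a
  proof -
    from x[rule_format, of 0] have "x \<in> R" by auto
    from RE[OF this] obtain a b where ab: "x = of_int a / of_int b" "\<not> int p dvd b" "b \<noteq> 0" by blast
    \<comment> \<open>With this exponent \<open>int p ^ k\<close> exceeds the absolute value of
      \<open>a\<close>, so divisibility leaves only \<open>a = 0\<close>.\<close>
    define k where "k = nat \<bar>a\<bar>"
    from x obtain y where y: "y \<in> R" "x = of_nat p ^ k * y" by blast
    from RE[OF y(1)] obtain c d where cd: "y = of_int c / of_int d" "\<not> int p dvd d" "d \<noteq> 0" by blast
    have "of_int (a * d) = (of_int (int p ^ k * c * b) :: 'a)"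
      using y(2) ab cd by (simp add: field_simps)
    then have "a * d = int p ^ k * c * b" by (simp only: of_int_eq_iff)
    then have "int p ^ k dvd d * a" by (simp add: mult_ac)
    moreover have "coprime (int p ^ k) d"
      using cd(2) pp by (simp add: prime_imp_coprime)
    ultimately have "int p ^ k dvd a" by (simp add: coprime_dvd_mult_right_iff)
    moreover have "\<bar>a\<bar> < int p ^ k"
    proof -
      have "k < p ^ k" using p1 by (simp add: power_gt_expt)
      then have "int k < int p ^ k" by (metis of_nat_less_iff of_nat_power)
      then show ?thesis by (simp add: k_def)
    qed
    ultimately have "a = 0" by (meson dvd_imp_le_int leD zero_less_abs_iff order_trans zdvd_imp_le abs_dvd_iff dvd_abs_iff linorder_not_le)
    then show ?thesis using ab by simp
  qed
  have fac: "of_nat p ^ j / fact j \<in> R" for j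
  proof -
    obtain q where q: "\<not> p dvd q" "fact j dvd p ^ j * q"
      using fact_dvd_prime_power[OF assms(1)] by blast
    then obtain c where c: "p ^ j * q = fact j * c" by blast
    from q(1) have q0: "q \<noteq> 0" by (metis dvd_0_right)
    have "of_nat (p ^ j * q) = (of_nat (fact j * c) :: 'a)" by (simp only: c)
    then have "of_nat p ^ j / fact j = (of_int (int c) / of_int (int q) :: 'a)"
      using q0 by (simp add: field_simps)
    then show ?thesis using RI[of "int q" "int c"] q(1) by (simp add: int_dvd_int_iff)
  qed
  have "\<forall>y\<in>R. (of_nat p)\<^sup>2 * y \<in> R"
    using ring by (auto intro!: subring_closed[OF ring])
  moreover have "\<exists>Q. finite Q \<and> (\<forall>a\<in>R. \<exists>q\<in>Q. \<exists>y\<in>R. a = q + (of_nat p)\<^sup>2 * y)"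
    using fin by (intro exI[of _ "of_int ` {0..<(int p)\<^sup>2}"]) auto
  moreover have "of_nat p \<in> R" "(of_nat p :: 'a) \<noteq> 0"
    using subring_of_nat[OF ring] p1 by auto
  ultimately show ?thesis
    unfolding padic_model_def using ring sep fac by blast
qed

lemma padic_field_Rats: "padic_field (\<rat> :: 'a::field_char_0 set)"
  unfolding padic_field_def
proof (intro conjI allI impI)
  show "subfield_set (\<rat> :: 'a set)"
    unfolding subfield_set_def subring_set_def by auto
next
  fix S :: "'a set" assume S: "finite S \<and> S \<subseteq> \<rat>"
  then obtain d where d: "d > 0" "\<forall>s\<in>S. \<exists>a::int. s = of_int a / (of_nat d :: 'a)"
    using common_denominator by blast
  obtain p :: nat where p: "Factorial_Ring.prime p" "p > d" using bigger_prime by blast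
  have "\<not> int p dvd int d" using p d(1) by (simp add: nat_dvd_not_less)
  then have "S \<subseteq> {of_int a / of_int b | a b. \<not> int p dvd b}"
    using d(2) by (smt (verit, best) mem_Collect_eq of_int_of_nat_eq subsetI)
  moreover have "{of_int a / of_int b | a b. \<not> int p dvd b} \<subseteq> (\<rat> :: 'a set)" by auto
  ultimately show "\<exists>\<pi> R A. padic_model \<pi> R A \<and> S \<subseteq> A \<and> R \<subseteq> \<rat>"
    using padic_model_localization[OF p(1)] by blast
qed

lemma padic_modelD:
  assumes "padic_model \<pi> R A"
  shows "subring_set R" "subring_set A" "A \<subseteq> R" "\<pi> \<in> R" "\<pi> \<noteq> 0"
    "\<And>y. y \<in> R \<Longrightarrow> \<pi>\<^sup>2 * y \<in> A"
    "\<And>x. (\<And>k. \<exists>y\<in>R. x = \<pi> ^ k * y) \<Longrightarrow> x = 0"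
    "\<And>j. \<pi> ^ j / fact j \<in> R"
  using assms unfolding padic_model_def by auto

lemma padic_model_finite:
  assumes "padic_model \<pi> R A"
  obtains Q where "finite Q" "\<And>a. a \<in> A \<Longrightarrow> \<exists>q\<in>Q. \<exists>y\<in>R. a = q + \<pi>\<^sup>2 * y"
  using assms unfolding padic_model_def by metis

text \<open>The multiples of \<open>\<pi>^2\<close> form an ideal of \<open>R\<close>, so adding
  them to \<open>A1\<close> gives a ring without new residues modulo \<open>\<pi>^2\<close>. For an
  extension this leaves separation in \<open>R\<close> and finiteness on \<open>A1\<close> to be
  checked.\<close>

lemma padic_model_extend:
  assumes m: "padic_model \<pi> R0 A0"
    and R: "subring_set R" "R0 \<subseteq> R"
    and A1: "subring_set A1" "A1 \<subseteq> R" "finite Q"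
      "\<And>a. a \<in> A1 \<Longrightarrow> \<exists>q\<in>Q. \<exists>y\<in>R. a = q + \<pi>\<^sup>2 * y"
    and sep: "\<And>x. (\<And>k. \<exists>y\<in>R. x = \<pi> ^ k * y) \<Longrightarrow> x = 0"
  shows "padic_model \<pi> R {a + \<pi>\<^sup>2 * y | a y. a \<in> A1 \<and> y \<in> R}" (is "padic_model \<pi> R ?A")
proof -
  note pi = padic_modelD(4,5)[OF m]
  note cl = subring_closed[OF R(1)]
  have pR: "\<pi> \<in> R" using pi R by auto
  have AI: "a + \<pi>\<^sup>2 * y \<in> ?A" if "a \<in> A1" "y \<in> R" for a y using that by blast
  have "subring_set ?A"
  proof (rule subring_setI)
    show "1 \<in> ?A" using AI[of 1 0] subring_one[OF A1(1)] subring_zero[OF R(1)] by simp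
  next
    fix x y assume "x \<in> ?A" "y \<in> ?A"
    then obtain a b c d where *: "x = a + \<pi>\<^sup>2 * b" "y = c + \<pi>\<^sup>2 * d" "a \<in> A1" "c \<in> A1" "b \<in> R" "d \<in> R"
      by blast
    have "x - y = (a - c) + \<pi>\<^sup>2 * (b - d)" by (simp add: * algebra_simps)
    then show "x - y \<in> ?A" using AI[OF subring_diff[OF A1(1) *(3,4)] cl(3)[OF *(5,6)]] by simp
    have "x * y = a * c + \<pi>\<^sup>2 * (a * d + b * c + \<pi>\<^sup>2 * (b * d))" by (simp add: * algebra_simps)
    moreover have "a * c \<in> A1" using * subring_mult[OF A1(1)] by blast
    moreover have "a * d + b * c + \<pi>\<^sup>2 * (b * d) \<in> R" using * A1(2) pR by (intro cl) auto
    ultimately show "x * y \<in> ?A" by blast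
  qed
  moreover have "?A \<subseteq> R" using A1(2) pR by (auto intro!: cl)
  moreover have "\<forall>y\<in>R. \<pi>\<^sup>2 * y \<in> ?A"
    using AI[of 0] subring_zero[OF A1(1)] by simp
  moreover have "\<forall>a\<in>?A. \<exists>q\<in>Q. \<exists>y\<in>R. a = q + \<pi>\<^sup>2 * y"
  proof
    fix x assume "x \<in> ?A"
    then obtain a y where *: "x = a + \<pi>\<^sup>2 * y" "a \<in> A1" "y \<in> R" by blast
    then obtain q z where **: "q \<in> Q" "z \<in> R" "a = q + \<pi>\<^sup>2 * z" using A1(4) by blast
    then have "x = q + \<pi>\<^sup>2 * (z + y)" using * by (simp add: algebra_simps)
    then show "\<exists>q\<in>Q. \<exists>y\<in>R. x = q + \<pi>\<^sup>2 * y" using **(1) cl(6)[OF **(2) *(3)] by blast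
  qed
  moreover have "\<forall>j. \<pi> ^ j / fact j \<in> R" using padic_modelD(8)[OF m] R(2) by auto
  ultimately show ?thesis
    unfolding padic_model_def using R(1) pR pi(2) A1(3) sep by blast
qed

lemma finite_range_coeff: "finite (range (Polynomial.coeff f))"
proof -
  have "Polynomial.coeff f i \<in> insert 0 (Polynomial.coeff f ` {..Polynomial.degree f})" for i
    by (cases "i \<le> Polynomial.degree f") (auto simp: not_le coeff_eq_0)
  then have "range (Polynomial.coeff f) \<subseteq> insert 0 (Polynomial.coeff f ` {..Polynomial.degree f})"
    by blast
  then show ?thesis by (rule finite_subset) auto
qed

section \<open>Adjoining a transcendental element\<close>

definition transcendental_over :: "'a::comm_ring_1 set \<Rightarrow> 'a \<Rightarrow> bool" where
  "transcendental_over F t \<longleftrightarrow> (\<forall>f\<in>polys F. poly f t = 0 \<longrightarrow> f = 0)"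

lemma transcendental_over_affine:
  fixes t :: "'a::field"
  assumes F: "subfield_set F" and t: "transcendental_over F t" and ce: "c \<in> F" "e \<in> F" "e \<noteq> 0"
  shows "transcendental_over F ((t - c) / e)"
  unfolding transcendental_over_def
proof (intro ballI impI)
  fix f assume f: "f \<in> polys F" "poly f ((t - c) / e) = 0"
  note R = subfield_ring[OF F]
  define l where "l = [: - c / e, 1 / e:]"
  have l: "l \<in> polys F"
    unfolding l_def using ce
    by (intro polys_closed[OF R] subfield_divide[OF F] subring_closed[OF R])
  have "pcompose f l \<in> polys F"
    using f(1)
    by (induction f) (auto simp: polys_pCons_iff pcompose_pCons polys_0[OF R]
      intro!: polys_closed[OF R] l)
  moreover have "poly (pcompose f l) t = 0"
    using f(2) ce(3) by (simp add: poly_pcompose l_def field_simps)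
  ultimately have "pcompose f l = 0"
    using t by (simp add: transcendental_over_def)
  moreover have "Polynomial.degree l = 1" using ce(3) by (simp add: l_def)
  ultimately show "f = 0" by (simp add: pcompose_eq_0_iff)
qed

lemma poly_values_subring:
  assumes "subring_set R"
  shows "subring_set ((\<lambda>f. poly f x) ` polys R)"
proof (rule subring_setI)
  show "1 \<in> (\<lambda>f. poly f x) ` polys R"
    using subring_one[OF subring_polys[OF assms]] by (intro image_eqI[of _ _ 1]) auto
next
  fix a b assume "a \<in> (\<lambda>f. poly f x) ` polys R" "b \<in> (\<lambda>f. poly f x) ` polys R"
  then obtain f g where fg: "f \<in> polys R" "g \<in> polys R" "a = poly f x" "b = poly g x" by auto
  show "a - b \<in> (\<lambda>f. poly f x) ` polys R"
    using fg polys_closed[OF assms] by (intro image_eqI[of _ _ "f - g"]) auto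
  show "a * b \<in> (\<lambda>f. poly f x) ` polys R"
    using fg polys_closed[OF assms] by (intro image_eqI[of _ _ "f * g"]) auto
qed

lemma poly_values_superset:
  assumes "subring_set R"
  shows "R \<subseteq> (\<lambda>f. poly f x) ` polys R" "x \<in> (\<lambda>f. poly f x) ` polys R"
proof -
  show "R \<subseteq> (\<lambda>f. poly f x) ` polys R"
    using polys_const[OF assms] by (auto intro!: image_eqI[of _ _ "[:_:]"])
  show "x \<in> (\<lambda>f. poly f x) ` polys R"
    using polys_closed[OF assms] subring_zero[OF assms] subring_one[OF assms]
    by (intro image_eqI[of _ _ "[:0, 1:]"]) auto
qed

lemma subfield_fractions:
  fixes t :: "'a::field"
  assumes F: "subfield_set F"
  shows "subfield_set {poly g t / poly h t | g h. g \<in> polys F \<and> h \<in> polys F}" (is "subfield_set ?K")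
proof -
  note R = subfield_ring[OF F]
  note cl = polys_closed[OF R]
  have KI: "poly g t / poly h t \<in> ?K" if "g \<in> polys F" "h \<in> polys F" for g h
    using that by blast
  \<comment> \<open>A fraction whose denominator vanishes at \<open>t\<close> is 0 by convention and
    is rewritten as 0 over 1.\<close>
  have KE: "\<exists>g h. g \<in> polys F \<and> h \<in> polys F \<and> x = poly g t / poly h t \<and> poly h t \<noteq> 0" if x: "x \<in> ?K" for x
  proof (cases "x = 0")
    case True
    then show ?thesis using cl(1) cl(5)
      by (intro exI[of _ 0] exI[of _ 1]) auto
  next
    case False
    with x show ?thesis by force
  qed
  show ?thesis
    unfolding subfield_set_def
  proof (intro conjI subring_setI ballI)
    show "1 \<in> ?K" using KI[of 1 1] cl(5) by simp
  next
    fix x y assume xy: "x \<in> ?K" "y \<in> ?K"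
    from KE[OF xy(1)] KE[OF xy(2)] obtain g h g' h' where *: "g \<in> polys F" "h \<in> polys F" "x = poly g t / poly h t" "poly h t \<noteq> 0"
      "g' \<in> polys F" "h' \<in> polys F" "y = poly g' t / poly h' t" "poly h' t \<noteq> 0"
      by (elim exE conjE)
    have "x - y = poly (g * h' - g' * h) t / poly (h * h') t"
      using *(4,8) unfolding *(3,7) by (simp add: field_simps)
    moreover have "g * h' - g' * h \<in> polys F" "h * h' \<in> polys F" "g * g' \<in> polys F"
      using *(1,2,5,6) by (auto intro!: cl(7,8))
    ultimately show "x - y \<in> ?K" by blast
    have "x * y = poly (g * g') t / poly (h * h') t" using *(3,7) by simp
    with \<open>h * h' \<in> polys F\<close> \<open>g * g' \<in> polys F\<close> show "x * y \<in> ?K" by blast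
  next
    fix x assume "x \<in> ?K"
    then obtain g h where "g \<in> polys F" "h \<in> polys F" "x = poly g t / poly h t" using KE by blast
    then show "inverse x \<in> ?K" using KI[of h g] by simp
  qed
qed

text \<open>
  After the substitution \<open>t = c + \<pi>\<^sup>2 x\<close> every polynomial in \<open>t\<close> is congruent to its value at
  \<open>c\<close>, so inverting the elements congruent to 1 makes all the required denominators invertible.
\<close>

lemma padic_field_transcendental:
  fixes t :: "'a::field_char_0"
  assumes F: "padic_field F" and t: "transcendental_over F t"
  shows "padic_field {poly g t / poly h t | g h. g \<in> polys F \<and> h \<in> polys F}" (is "padic_field ?K")
  unfolding padic_field_def
proof (intro conjI allI impI)
  have Ff: "subfield_set F" using F by (simp add: padic_field_def)
  note FR = subfield_ring[OF Ff]
  show K: "subfield_set ?K" using subfield_fractions[OF Ff] .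
  note KR = subfield_ring[OF K]
  fix S assume S: "finite S \<and> S \<subseteq> ?K"
  have "\<exists>g h. g \<in> polys F \<and> h \<in> polys F \<and> h \<noteq> 0 \<and> s = poly g t / poly h t" if "s \<in> S" for s
  proof (cases "s = 0")
    case True
    then show ?thesis using polys_closed[OF FR]
      by (intro exI[of _ 0] exI[of _ 1]) auto
  next
    case False
    with S that show ?thesis by force
  qed
  then obtain g h where gh: "\<And>s. s \<in> S \<Longrightarrow> g s \<in> polys F" "\<And>s. s \<in> S \<Longrightarrow> h s \<in> polys F"
    "\<And>s. s \<in> S \<Longrightarrow> h s \<noteq> 0" "\<And>s. s \<in> S \<Longrightarrow> s = poly (g s) t / poly (h s) t"
    by metis
  \<comment> \<open>A nonzero product has finitely many roots, so some natural number
    \<open>c\<close> keeps every denominator nonzero. Being a natural number, \<open>c\<close> lies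
    in every subring.\<close>
  have "(\<Prod>s\<in>S. h s) \<noteq> 0" using S gh(3) by simp
  then have "finite {x. poly (\<Prod>s\<in>S. h s) x = 0}" by (rule poly_roots_finite)
  moreover have "infinite (range (of_nat :: nat \<Rightarrow> 'a))"
    by (simp add: range_inj_infinite inj_of_nat)
  ultimately obtain n :: nat where n: "poly (\<Prod>s\<in>S. h s) (of_nat n) \<noteq> 0"
    by (metis (mono_tags, lifting) finite_subset image_subsetI mem_Collect_eq)
  define c :: 'a where "c = of_nat n"
  have hc: "poly (h s) c \<noteq> 0" if "s \<in> S" for s
    using n that S by (auto simp: poly_prod c_def)
  have cF: "c \<in> F" unfolding c_def by (rule subring_of_nat[OF FR])
  \<comment> \<open>Including the inverses makes the values of the denominators at \<open>c\<close>
    units of \<open>A0\<close>.\<close>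
  define S0 where "S0 = (\<Union>s\<in>S. range (Polynomial.coeff (g s)) \<union> range (Polynomial.coeff (h s)))
    \<union> (\<lambda>s. inverse (poly (h s) c)) ` S"
  have "finite S0" using S by (simp add: S0_def finite_range_coeff)
  moreover have "S0 \<subseteq> F"
  proof -
    have "range (Polynomial.coeff (g s)) \<subseteq> F" "range (Polynomial.coeff (h s)) \<subseteq> F"
      "inverse (poly (h s) c) \<in> F" if "s \<in> S" for s
      using gh(1,2)[OF that] subfield_inverse[OF Ff poly_in_subring[OF FR gh(2)[OF that] cF]]
      by (auto simp: polys_def)
    then show ?thesis unfolding S0_def
      by (intro Un_least UN_least image_subsetI) (simp_all add: image_subset_iff)
  qed
  ultimately have "\<exists>\<pi> R A. padic_model \<pi> R A \<and> S0 \<subseteq> A \<and> R \<subseteq> F"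
    using F by (simp add: padic_field_def)
  then obtain \<pi> R0 A0 where m: "padic_model \<pi> R0 A0" "S0 \<subseteq> A0" "R0 \<subseteq> F"
    by blast
  note R0 = padic_modelD(1)[OF m(1)] and A0 = padic_modelD(2,3)[OF m(1)]
    and pi = padic_modelD(4,5)[OF m(1)]
  define e where "e = \<pi>\<^sup>2"
  have e: "e \<in> R0" "e \<noteq> 0" "e \<in> F" using pi m(3) by (auto simp: e_def intro!: subring_power[OF R0])
  define x where "x = (t - c) / e"
  have tx: "t = c + e * x" using e by (simp add: x_def)
  have x: "transcendental_over F x" unfolding x_def
    by (rule transcendental_over_affine[OF Ff t cF e(3,2)])
  define R1 where "R1 = (\<lambda>f. poly f x) ` polys R0"
  have R1: "subring_set R1" unfolding R1_def by (rule poly_values_subring[OF R0])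
  have R01: "R0 \<subseteq> R1" "x \<in> R1" unfolding R1_def using poly_values_superset[OF R0] by auto
  note cl1 = subring_closed[OF R1]
  have eR1: "e \<in> R1" "\<pi> \<in> R1" using e pi R01 by auto
  \<comment> \<open>Since \<open>x\<close> is transcendental over \<open>F\<close>, an element of
    \<open>R1\<close> determines its coefficients, and separation is inherited from
    \<open>R0\<close> coefficient by coefficient.\<close>
  have sep1: "y = 0" if y: "\<And>k. \<exists>z\<in>R1. y = \<pi> ^ k * z" for y
  proof -
    from y[of 0] obtain f where f: "f \<in> polys R0" "y = poly f x" by (auto simp: R1_def)
    have "Polynomial.coeff f i = 0" for i
    proof (rule padic_modelD(7)[OF m(1)])
      fix k
      from y[of k] obtain f' where f': "f' \<in> polys R0" "y = \<pi> ^ k * poly f' x"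
        by (auto simp: R1_def)
      define d where "d = f - Polynomial.smult (\<pi> ^ k) f'"
      have "d \<in> polys R0"
        unfolding d_def using f f' pi by (intro polys_closed[OF R0] subring_closed[OF R0])
      then have "d \<in> polys F" using polys_mono[OF m(3)] by auto
      moreover have "poly d x = 0" using f f' by (simp add: d_def)
      ultimately have "d = 0" using x by (auto simp: transcendental_over_def)
      then have "Polynomial.coeff f i = \<pi> ^ k * Polynomial.coeff f' i" by (simp add: d_def)
      then show "\<exists>z\<in>R0. Polynomial.coeff f i = \<pi> ^ k * z" using f'(1) by (auto simp: polys_def)
    qed
    then have "f = 0" by (simp add: poly_eqI)
    then show "y = 0" by (simp add: f)
  qed
  \<comment> \<open>\<open>V\<close> is the multiplicative set of elements congruent to 1 modulo
    \<open>e\<close>, and \<open>R\<close> is the localization of \<open>R1\<close> at it.\<close>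
  define V where "V = {1 + e * y | y. y \<in> R1}"
  define R where "R = {u / v | u v. u \<in> R1 \<and> v \<in> V}"
  have V1: "1 \<in> V" unfolding V_def using cl1(2) by force
  have VR: "V \<subseteq> R1" unfolding V_def using eR1 by (auto intro!: cl1)
  have Vm: "v * w \<in> V" if "v \<in> V" "w \<in> V" for v w
  proof -
    from that obtain y z where yz: "v = 1 + e * y" "w = 1 + e * z" "y \<in> R1" "z \<in> R1"
      by (auto simp: V_def)
    then have "v * w = 1 + e * (y + z + e * (y * z))" by (simp add: algebra_simps)
    moreover have "y + z + e * (y * z) \<in> R1" using yz eR1 by (intro cl1)
    ultimately show ?thesis unfolding V_def by blast
  qed
  \<comment> \<open>Modulo \<open>\<pi> ^ k\<close> the element \<open>v\<close> is invertible: its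
    product with the geometric series in \<open>- (e * y)\<close>, cut off at \<open>k\<close>,
    differs from 1 by \<open>(- (e * y)) ^ k\<close>, a multiple of
    \<open>\<pi> ^ k\<close>.\<close>
  have cancel: "\<exists>z\<in>R1. u = \<pi> ^ k * z" if u: "u \<in> R1" "v \<in> V" "w \<in> R1" "u * v = \<pi> ^ k * w" for u v w k
  proof -
    from u obtain y where y: "v = 1 + e * y" "y \<in> R1" by (auto simp: V_def)
    have "u = \<pi> ^ k * (w * (\<Sum>i<k. (- (e * y)) ^ i)) + (- (e * y)) ^ k * u"
    proof -
      have "(1 + e * y) * (\<Sum>i<k. (- (e * y)) ^ i) = 1 - (- (e * y)) ^ k"
        using one_diff_power_eq[of "- (e * y)" k] by simp
      then have "u * v * (\<Sum>i<k. (- (e * y)) ^ i) = u * (1 - (- (e * y)) ^ k)"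
        by (simp add: y mult.assoc)
      then have "\<pi> ^ k * w * (\<Sum>i<k. (- (e * y)) ^ i) = u * (1 - (- (e * y)) ^ k)"
        by (simp only: u(4))
      then show ?thesis by (simp add: algebra_simps)
    qed
    also have "(- (e * y)) ^ k = \<pi> ^ k * (- (\<pi> * y)) ^ k"
      by (simp add: e_def power2_eq_square flip: power_mult_distrib) (simp add: mult_ac)
    finally have "u = \<pi> ^ k * (w * (\<Sum>i<k. (- (e * y)) ^ i) + (- (\<pi> * y)) ^ k * u)"
      by (simp add: algebra_simps)
    moreover have "w * (\<Sum>i<k. (- (e * y)) ^ i) + (- (\<pi> * y)) ^ k * u \<in> R1"
      using u y eR1 by (intro cl1) 
    ultimately show ?thesis by blast
  qed
  \<comment> \<open>Were 0 in \<open>V\<close>, cancelling it would make 1 divisible by every power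
    of \<open>\<pi>\<close>.\<close>
  have V0: "v \<noteq> 0" if "v \<in> V" for v
  proof
    assume "v = 0"
    then have "1 = (0::'a)"
      using cancel[OF cl1(1) that cl1(2)] by (intro sep1) simp
    then show False by simp
  qed
  have R1R: "R1 \<subseteq> R" unfolding R_def using V1 by force
  have R: "subring_set R"
  proof (rule subring_setI)
    show "1 \<in> R" using R1R cl1(1) by auto
  next
    fix a b assume "a \<in> R" "b \<in> R"
    then obtain u v u' v' where *: "a = u / v" "u \<in> R1" "v \<in> V" "b = u' / v'" "u' \<in> R1" "v' \<in> V"
      by (auto simp: R_def)
    have v: "v \<in> R1" "v' \<in> R1" "v \<noteq> 0" "v' \<noteq> 0" using * VR V0 by auto
    have "a - b = (u * v' - u' * v) / (v * v')" unfolding *(1,4) using v by (simp add: field_simps)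
    moreover have "u * v' - u' * v \<in> R1" using * v by (intro cl1)
    ultimately show "a - b \<in> R" using Vm[OF *(3,6)] unfolding R_def by blast
    have "a * b = (u * u') / (v * v')" by (simp add: *)
    moreover have "u * u' \<in> R1" using * by (intro cl1)
    ultimately show "a * b \<in> R" using Vm[OF *(3,6)] unfolding R_def by blast
  qed
  note cl = subring_closed[OF R]
  have sep: "y = 0" if y: "\<And>k. \<exists>z\<in>R. y = \<pi> ^ k * z" for y
  proof -
    from y[of 0] obtain u v where uv: "y = u / v" "u \<in> R1" "v \<in> V" by (auto simp: R_def)
    have "u = 0"
    proof (rule sep1)
      fix k
      from y[of k] obtain u' v' where *: "y = \<pi> ^ k * (u' / v')" "u' \<in> R1" "v' \<in> V"
        by (auto simp: R_def)
      have "u * v' = \<pi> ^ k * (u' * v)" using * uv V0[of v] V0[of v'] by (simp add: field_simps)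
      moreover have "u' * v \<in> R1" using * uv VR by (intro cl1) auto
      ultimately show "\<exists>z\<in>R1. u = \<pi> ^ k * z" using cancel uv *(3) by blast
    qed
    then show "y = 0" by (simp add: uv)
  qed
  obtain Q where Q: "finite Q" "\<And>a. a \<in> A0 \<Longrightarrow> \<exists>q\<in>Q. \<exists>y\<in>R0. a = q + \<pi>\<^sup>2 * y"
    using padic_model_finite[OF m(1)] by blast
  define A where "A = {a + \<pi>\<^sup>2 * y | a y. a \<in> A0 \<and> y \<in> R}"
  have "padic_model \<pi> R A" unfolding A_def
  proof (rule padic_model_extend[OF m(1) R _ A0(1) _ Q(1) _ sep])
    show "R0 \<subseteq> R" "A0 \<subseteq> R" using R01 R1R A0(2) by auto
    show "\<exists>q\<in>Q. \<exists>y\<in>R. a = q + \<pi>\<^sup>2 * y" if "a \<in> A0" for a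
      using Q(2)[OF that] R01(1) R1R by blast
  qed
  moreover have "S \<subseteq> A"
  proof
    fix s assume s: "s \<in> S"
    have gA: "g s \<in> polys A0" and hA: "h s \<in> polys A0" and iA: "inverse (poly (h s) c) \<in> A0"
      using s m(2) unfolding S0_def polys_def by blast+
    have gR: "g s \<in> polys R1" and hR: "h s \<in> polys R1" and iR: "inverse (poly (h s) c) \<in> R1"
      using gA hA iA polys_mono[of A0 R1] A0(2) R01(1) by blast+
    define i where "i = inverse (poly (h s) c)"
    have cA: "c \<in> A0" unfolding c_def by (rule subring_of_nat[OF A0(1)])
    then have cR: "c \<in> R1" using A0(2) R01(1) by auto
    obtain y where y: "y \<in> R1" "poly (g s) t = poly (g s) c + e * y"
      using poly_shift_cong[OF R1 gR cR R01(2) eR1(1)] tx by auto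
    obtain z where z: "z \<in> R1" "poly (h s) t = poly (h s) c + e * z"
      using poly_shift_cong[OF R1 hR cR R01(2) eR1(1)] tx by auto
    define v where "v = 1 + e * (i * z)"
    have v: "v \<in> V" unfolding v_def V_def i_def using iR z(1) cl1(4) by blast
    have iv: "poly (h s) t = v / i" using z(2) hc[OF s] by (simp add: v_def i_def field_simps)
    have i0: "i \<noteq> 0" using hc[OF s] by (simp add: i_def)
    have s_eq: "s = i * (poly (g s) c + e * y) / v"
      using gh(4)[OF s] i0 by (simp add: iv y(2) mult.commute)
    \<comment> \<open>Dropping \<open>e * y\<close> and replacing \<open>1 / v\<close> by 1 changes
      the fraction by a multiple of \<open>e\<close>. What remains, \<open>i * G\<close>, will come
      from \<open>A0\<close>.\<close>
    have "i * (G + e * y) / v = i * G + e * ((i * y - i * G * (i * z)) / v)" for G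
    proof -
      have "i * (G + e * y) = i * G * v + e * (i * y - i * G * (i * z))"
        by (simp add: v_def algebra_simps)
      then show ?thesis using V0[OF v] by (simp add: add_divide_distrib)
    qed
    from this[of "poly (g s) c"]
    have "s = i * poly (g s) c + e * ((i * y - i * poly (g s) c * (i * z)) / v)"
      by (rule trans[OF s_eq])
    moreover have "i * poly (g s) c \<in> A0"
      using iA gA cA unfolding i_def by (intro subring_mult[OF A0(1)] poly_in_subring[OF A0(1)])
    moreover have "i * y - i * poly (g s) c * (i * z) \<in> R1"
      using iR y z gR cR unfolding i_def by (intro cl1 poly_in_subring[OF R1])
    ultimately show "s \<in> A" unfolding A_def R_def e_def using v by blast
  qed
  moreover have "R \<subseteq> ?K"
  proof -
    have sub: "F \<subseteq> ?K" "t \<in> ?K"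
    proof -
      show "F \<subseteq> ?K"
      proof
        fix a assume "a \<in> F"
        then have "[:a:] \<in> polys F" "1 \<in> polys F" using polys_closed[OF FR] by auto
        moreover have "a = poly [:a:] t / poly 1 t" by simp
        ultimately show "a \<in> ?K" by blast
      qed
      have "[:0,1:] \<in> polys F" "1 \<in> polys F"
        using polys_closed[OF FR] subring_zero[OF FR] subring_one[OF FR] by auto
      moreover have "t = poly [:0,1:] t / poly 1 t" by simp
      ultimately show "t \<in> ?K" by blast
    qed
    have xK: "x \<in> ?K"
      unfolding x_def using sub cF e by (intro subfield_divide[OF K] subring_diff[OF KR]) auto
    have "R1 \<subseteq> ?K"
    proof -
      have "polys R0 \<subseteq> polys ?K" using sub m(3) by (intro polys_mono) blast
      then show ?thesis unfolding R1_def
        by (intro image_subsetI poly_in_subring[OF KR] xK) blast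
    qed
    then have "u / v \<in> ?K" if "u \<in> R1" "v \<in> V" for u v
      using that VR subfield_divide[OF K, of u v] by (meson subsetD)
    then show ?thesis unfolding R_def by (intro subsetI) (elim CollectE exE conjE; simp only:)
  qed
  ultimately show "\<exists>\<pi> R A. padic_model \<pi> R A \<and> S \<subseteq> A \<and> R \<subseteq> ?K" by blast
qed

section \<open>Adjoining an algebraic element\<close>

lemma minimal_polynomial:
  fixes t :: "'a::field"
  assumes F: "subfield_set F" and t: "\<not> transcendental_over F t"
  obtains m where "m \<in> polys F" "Polynomial.lead_coeff m = 1" "Polynomial.degree m > 0" "poly m t = 0"
    "\<And>f. f \<in> polys F \<Longrightarrow> poly f t = 0 \<Longrightarrow> Polynomial.degree f < Polynomial.degree m \<Longrightarrow> f = 0"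
proof -
  define P where "P = (\<lambda>f. f \<in> polys F \<and> f \<noteq> 0 \<and> poly f t = 0)"
  obtain f where "P f" using t by (auto simp: P_def transcendental_over_def)
  then obtain f where f: "P f" and min: "\<And>g. P g \<Longrightarrow> Polynomial.degree f \<le> Polynomial.degree g"
    using ex_has_least_nat[of P f Polynomial.degree] by blast
  define m where "m = Polynomial.smult (inverse (Polynomial.lead_coeff f)) f"
  have lc: "Polynomial.lead_coeff f \<noteq> 0" using f by (simp add: P_def)
  have deg: "Polynomial.degree m = Polynomial.degree f" using lc by (simp add: m_def)
  have "m \<in> polys F"
    using f unfolding m_def P_def
    by (auto intro!: polys_smult[OF subfield_ring[OF F]] subfield_inverse[OF F] polysD)
  moreover have "Polynomial.lead_coeff m = 1" using lc by (simp add: m_def)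
  moreover have "poly m t = 0" using f by (simp add: m_def P_def)
  moreover have "Polynomial.degree m > 0"
  proof (rule ccontr)
    assume "\<not> Polynomial.degree m > 0"
    then obtain a where "f = [:a:]" using deg degree_eq_zeroE by auto
    with f show False by (auto simp: P_def)
  qed
  moreover have "g = 0" if "g \<in> polys F" "poly g t = 0" "Polynomial.degree g < Polynomial.degree m" for g
    using min[of g] that deg by (auto simp: P_def)
  ultimately show ?thesis using that by blast
qed

text \<open>The representative is the remainder modulo the monic \<open>m\<close>. It is needed over
  the field \<open>F\<close> and also over the rings \<open>A0\<close> and
  \<open>R0\<close>.\<close>

lemma poly_values_lowdeg:
  assumes B: "subring_set B" and m: "m \<in> polys B" "Polynomial.lead_coeff m = 1"
    "Polynomial.degree m > 0" "poly m t = 0"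
    and x: "x \<in> (\<lambda>f. poly f t) ` polys B"
  obtains f where "f \<in> polys B" "Polynomial.degree f < Polynomial.degree m" "x = poly f t"
proof -
  from x obtain g where g: "g \<in> polys B" "x = poly g t" by auto
  obtain q r where qr: "g = q * m + r" "r \<in> polys B" "Polynomial.degree r < Polynomial.degree m"
    using monic_division[OF B m(1-3) g(1)] by blast
  then show ?thesis using that[of r] g m by simp
qed

lemma subfield_poly_values:
  fixes t :: "'a::field"
  assumes F: "subfield_set F" and t: "\<not> transcendental_over F t"
  shows "subfield_set ((\<lambda>f. poly f t) ` polys F)"
proof -
  note FR = subfield_ring[OF F]
  note cl = polys_closed[OF FR]
  obtain m where m: "m \<in> polys F" "Polynomial.lead_coeff m = 1" "Polynomial.degree m > 0" "poly m t = 0"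
    and min: "\<And>f. f \<in> polys F \<Longrightarrow> poly f t = 0 \<Longrightarrow> Polynomial.degree f < Polynomial.degree m \<Longrightarrow> f = 0"
    using minimal_polynomial[OF F t] by blast
  \<comment> \<open>Dividing \<open>m\<close> by a monic multiple of \<open>h\<close> leaves a
    remainder of smaller degree than \<open>h\<close>, nonzero at \<open>t\<close> by minimality.
    Inverting its value by induction inverts that of \<open>h\<close>.\<close>
  have inv: "\<exists>q\<in>polys F. poly q t * poly h t = 1"
    if "h \<in> polys F" "Polynomial.degree h < Polynomial.degree m" "poly h t \<noteq> 0" for h
    using that
  proof (induction "Polynomial.degree h" arbitrary: h rule: less_induct)
    case less
    show ?case
    proof (cases "Polynomial.degree h = 0")
      case True
      then obtain a where a: "h = [:a:]" by (rule degree_eq_zeroE)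
      with less.prems have "a \<in> F" "a \<noteq> 0" by (auto simp: polys_pCons_iff)
      then have "[:inverse a:] \<in> polys F" "poly [:inverse a:] t * poly h t = 1"
        using a by (auto intro!: cl(3) subfield_inverse[OF F])
      then show ?thesis by blast
    next
      case False
      define c where "c = inverse (Polynomial.lead_coeff h)"
      define h' where "h' = Polynomial.smult c h"
      have h0: "h \<noteq> 0" using less.prems by auto
      have c: "c \<in> F" "c \<noteq> 0"
        using h0 less.prems(1) by (auto simp: c_def intro!: subfield_inverse[OF F] polysD)
      have h': "h' \<in> polys F" "Polynomial.degree h' = Polynomial.degree h" "Polynomial.lead_coeff h' = 1"
        using c h0 less.prems(1) by (auto simp: h'_def c_def intro!: cl(4))
      obtain q r where qr: "q \<in> polys F" "r \<in> polys F" "m = q * h' + r"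
        "Polynomial.degree r < Polynomial.degree h'"
        using monic_division[OF FR h'(1,3) _ m(1)] h'(2) False by auto
      have h't: "poly h' t = c * poly h t" by (simp add: h'_def)
      have eq: "poly q t * (c * poly h t) + poly r t = 0"
        using m(4) by (simp add: qr(3) h't)
      \<comment> \<open>Otherwise \<open>m = q * h'\<close>, where \<open>q\<close> vanishes at
        \<open>t\<close> and has smaller degree than \<open>m\<close>.\<close>
      have "poly r t \<noteq> 0"
      proof
        assume r: "poly r t = 0"
        then have r0: "r = 0" using min[OF qr(2)] qr(4) h'(2) less.prems(2) by simp
        have qt: "poly q t = 0" using eq r c less.prems(3) by simp
        have q0: "q \<noteq> 0" using qr(3) r0 m(3) by auto
        moreover have "h' \<noteq> 0" using h'(3) by auto
        ultimately have "Polynomial.degree m = Polynomial.degree q + Polynomial.degree h"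
          using qr(3) r0 h'(2) by (simp add: Polynomial.degree_mult_eq)
        then have "Polynomial.degree q < Polynomial.degree m" using False by simp
        then show False using min[OF qr(1) qt] q0 by simp
      qed
      then obtain s where s: "s \<in> polys F" "poly s t * poly r t = 1"
        using less.hyps[of r] qr less.prems(2) h'(2) by auto
      have "poly (Polynomial.smult c (- (s * q))) t * poly h t = poly s t * poly r t"
      proof -
        have "poly r t = - (poly q t * (c * poly h t))" using eq by (simp add: eq_neg_iff_add_eq_0 add.commute)
        then show ?thesis by (simp add: algebra_simps)
      qed
      moreover have "Polynomial.smult c (- (s * q)) \<in> polys F" using s qr c by (intro cl)
      ultimately show ?thesis using s(2) by metis
    qed
  qed
  show ?thesis unfolding subfield_set_def
  proof (intro conjI ballI)
    show "subring_set ((\<lambda>f. poly f t) ` polys F)" by (rule poly_values_subring[OF FR])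
    fix x assume x: "x \<in> (\<lambda>f. poly f t) ` polys F"
    show "inverse x \<in> (\<lambda>f. poly f t) ` polys F"
    proof (cases "x = 0")
      case True
      then show ?thesis using x by simp
    next
      case False
      obtain f where f: "f \<in> polys F" "Polynomial.degree f < Polynomial.degree m" "x = poly f t"
        using poly_values_lowdeg[OF FR m x] by blast
      then obtain q where q: "q \<in> polys F" "poly q t * x = 1" using inv False by blast
      then have "inverse x = poly q t" using False by (metis inverse_unique mult.commute)
      with q show ?thesis by auto
    qed
  qed
qed

lemma poly_eq_sum_lessThan:
  fixes f :: "'a::comm_ring_1 poly"
  assumes "Polynomial.degree f < d"
  shows "poly f t = (\<Sum>i<d. Polynomial.coeff f i * t ^ i)"
  unfolding poly_altdef
  by (rule sum.mono_neutral_left) (use assms in \<open>auto simp: coeff_eq_0\<close>)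

text \<open>Once the coefficients of the monic \<open>m\<close> lie in \<open>A0\<close>, the powers
  of \<open>t\<close> below \<open>d\<close> form a basis of the values of polynomials over
  \<open>R0\<close>: they span by reduction and are independent by minimality over \<open>F\<close>.
  Finiteness and separation are then checked on coordinates.\<close>

lemma padic_field_algebraic:
  fixes t :: "'a::field_char_0"
  assumes F: "padic_field F" and t: "\<not> transcendental_over F t"
  shows "padic_field ((\<lambda>f. poly f t) ` polys F)" (is "padic_field ?K")
  unfolding padic_field_def
proof (intro conjI allI impI)
  have Ff: "subfield_set F" using F by (simp add: padic_field_def)
  note FR = subfield_ring[OF Ff]
  show K: "subfield_set ?K" by (rule subfield_poly_values[OF Ff t])
  obtain m where m: "m \<in> polys F" "Polynomial.lead_coeff m = 1" "Polynomial.degree m > 0" "poly m t = 0"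
    and min: "\<And>f. f \<in> polys F \<Longrightarrow> poly f t = 0 \<Longrightarrow> Polynomial.degree f < Polynomial.degree m \<Longrightarrow> f = 0"
    using minimal_polynomial[OF Ff t] by blast
  define d where "d = Polynomial.degree m"
  fix S assume S: "finite S \<and> S \<subseteq> ?K"
  then have "\<forall>s\<in>S. \<exists>g. g \<in> polys F \<and> s = poly g t" by auto
  from bchoice[OF this] obtain g where "\<forall>s\<in>S. g s \<in> polys F \<and> s = poly (g s) t" ..
  then have g: "\<And>s. s \<in> S \<Longrightarrow> g s \<in> polys F" "\<And>s. s \<in> S \<Longrightarrow> s = poly (g s) t"
    by auto
  define S0 where "S0 = (\<Union>s\<in>S. range (Polynomial.coeff (g s))) \<union> range (Polynomial.coeff m)"
  have "finite S0" using S by (simp add: S0_def finite_range_coeff)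
  moreover have "S0 \<subseteq> F"
    unfolding S0_def using g(1) m(1) by (intro Un_least UN_least) (auto simp: polys_def)
  ultimately have "\<exists>\<pi> R A. padic_model \<pi> R A \<and> S0 \<subseteq> A \<and> R \<subseteq> F"
    using F by (simp add: padic_field_def)
  then obtain \<pi> R0 A0 where M: "padic_model \<pi> R0 A0" "S0 \<subseteq> A0" "R0 \<subseteq> F"
    by blast
  note R0 = padic_modelD(1)[OF M(1)] and A0 = padic_modelD(2,3)[OF M(1)]
    and pi = padic_modelD(4,5)[OF M(1)]
  have mA: "m \<in> polys A0" and gA: "\<And>s. s \<in> S \<Longrightarrow> g s \<in> polys A0"
    using M(2) unfolding S0_def polys_def by blast+
  have mR: "m \<in> polys R0" using mA polys_mono[OF A0(2)] by blast
  define R where "R = (\<lambda>f. poly f t) ` polys R0"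
  define A1 where "A1 = (\<lambda>f. poly f t) ` polys A0"
  have R: "subring_set R" unfolding R_def by (rule poly_values_subring[OF R0])
  have A1: "subring_set A1" unfolding A1_def by (rule poly_values_subring[OF A0(1)])
  have R0R: "R0 \<subseteq> R" "t \<in> R" unfolding R_def using poly_values_superset[OF R0] by auto
  have A1R: "A1 \<subseteq> R" unfolding A1_def R_def using polys_mono[OF A0(2)] by auto
  obtain Q0 where Q0: "finite Q0" "\<And>a. a \<in> A0 \<Longrightarrow> \<exists>q\<in>Q0. \<exists>y\<in>R0. a = q + \<pi>\<^sup>2 * y"
    using padic_model_finite[OF M(1)] by blast
  \<comment> \<open>One representative from \<open>Q0\<close> for each of the \<open>d\<close>
    coordinates.\<close>
  define Q where "Q = (\<lambda>c. \<Sum>i<d. c i * t ^ i) ` ({..<d} \<rightarrow>\<^sub>E Q0)"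
  have Q: "finite Q" unfolding Q_def using Q0(1) by (intro finite_imageI finite_PiE) auto
  have A1Q: "\<exists>q\<in>Q. \<exists>y\<in>R. a = q + \<pi>\<^sup>2 * y" if a: "a \<in> A1" for a
  proof -
    obtain f where f: "f \<in> polys A0" "Polynomial.degree f < d" "a = poly f t"
      using poly_values_lowdeg[OF A0(1) mA m(2-4) a[unfolded A1_def]] unfolding d_def by blast
    have "\<exists>q y. q \<in> Q0 \<and> y \<in> R0 \<and> Polynomial.coeff f i = q + \<pi>\<^sup>2 * y" for i
      using Q0(2)[OF polysD[OF f(1)]] by blast
    then obtain q y where qy: "\<And>i. q i \<in> Q0" "\<And>i. y i \<in> R0"
      "\<And>i. Polynomial.coeff f i = q i + \<pi>\<^sup>2 * y i" by metis
    have "a = (\<Sum>i<d. (q i + \<pi>\<^sup>2 * y i) * t ^ i)"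
      using poly_eq_sum_lessThan[OF f(2)] f(3) qy(3) by simp
    also have "\<dots> = (\<Sum>i<d. restrict q {..<d} i * t ^ i) + \<pi>\<^sup>2 * (\<Sum>i<d. y i * t ^ i)"
      by (simp add: algebra_simps sum.distrib sum_distrib_left)
    finally have "a = (\<Sum>i<d. restrict q {..<d} i * t ^ i) + \<pi>\<^sup>2 * (\<Sum>i<d. y i * t ^ i)" .
    moreover have "(\<Sum>i<d. y i * t ^ i) \<in> R"
      using qy(2) R0R by (intro subring_sum[OF R] subring_mult[OF R] subring_power[OF R]) auto
    moreover have "(\<Sum>i<d. restrict q {..<d} i * t ^ i) \<in> Q"
      unfolding Q_def using qy(1) by (intro image_eqI[of _ _ "restrict q {..<d}"]) auto
    ultimately show ?thesis by blast
  qed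
  have sep: "x = 0" if x: "\<And>k. \<exists>y\<in>R. x = \<pi> ^ k * y" for x
  proof -
    from x[of 0] have "x \<in> R" by auto
    obtain f where f: "f \<in> polys R0" "Polynomial.degree f < d" "x = poly f t"
      using poly_values_lowdeg[OF R0 mR m(2-4) \<open>x \<in> R\<close>[unfolded R_def]] unfolding d_def by blast
    have "Polynomial.coeff f i = 0" for i
    proof (rule padic_modelD(7)[OF M(1)])
      fix k
      from x[of k] obtain y where y: "y \<in> R" "x = \<pi> ^ k * y" by blast
      obtain f' where f': "f' \<in> polys R0" "Polynomial.degree f' < d" "y = poly f' t"
        using poly_values_lowdeg[OF R0 mR m(2-4) y(1)[unfolded R_def]] unfolding d_def by blast
      define e where "e = f - Polynomial.smult (\<pi> ^ k) f'"
      have "e \<in> polys R0"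
        unfolding e_def using f f' pi by (intro polys_closed[OF R0] subring_closed[OF R0])
      then have "e \<in> polys F" using polys_mono[OF M(3)] by auto
      moreover have "poly e t = 0" using f(3) f'(3) y(2) by (simp add: e_def)
      moreover have "Polynomial.degree e < d"
        unfolding e_def using f(2) f'(2) degree_smult_le[of "\<pi> ^ k" f']
        by (intro degree_diff_less) auto
      ultimately have "e = 0" using min unfolding d_def by blast
      then have "Polynomial.coeff f i = \<pi> ^ k * Polynomial.coeff f' i" by (simp add: e_def)
      then show "\<exists>z\<in>R0. Polynomial.coeff f i = \<pi> ^ k * z" using f'(1) by (auto simp: polys_def)
    qed
    then have "f = 0" by (simp add: poly_eqI)
    then show "x = 0" by (simp add: f)
  qed
  define A where "A = {a + \<pi>\<^sup>2 * y | a y. a \<in> A1 \<and> y \<in> R}"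
  have "padic_model \<pi> R A" unfolding A_def
    by (rule padic_model_extend[OF M(1) R R0R(1) A1 A1R Q A1Q sep])
  moreover have "S \<subseteq> A"
  proof
    fix s assume s: "s \<in> S"
    have "s \<in> A1" unfolding A1_def using gA[OF s] g(2)[OF s] by blast
    moreover have "s = s + \<pi>\<^sup>2 * 0" by simp
    ultimately show "s \<in> A" unfolding A_def using subring_zero[OF R] by blast
  qed
  moreover have "R \<subseteq> ?K" unfolding R_def using polys_mono[OF M(3)] by auto
  ultimately show "\<exists>\<pi> R A. padic_model \<pi> R A \<and> S \<subseteq> A \<and> R \<subseteq> ?K" by blast
qed

text \<open>The elements of \<open>S\<close> are adjoined to the rationals one at a time, each being
  transcendental or algebraic over the field reached so far.\<close>

theorem padic_model_exists:
  fixes S :: "'a::field_char_0 set"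
  assumes "finite S"
  obtains \<pi> R A where "padic_model \<pi> R A" "S \<subseteq> A"
proof -
  have "\<exists>F. padic_field F \<and> S \<subseteq> F"
    using assms
  proof (induction S rule: finite_induct)
    case empty
    then show ?case using padic_field_Rats by blast
  next
    case (insert t S)
    then obtain F where F: "padic_field F" "S \<subseteq> F" by blast
    then have Ff: "subfield_set F" by (simp add: padic_field_def)
    note FR = subfield_ring[OF Ff]
    note sup = poly_values_superset[OF FR, of t]
    show ?case
    proof (cases "transcendental_over F t")
      case False
      then show ?thesis using padic_field_algebraic[OF F(1) False] F(2) sup by blast
    next
      case True
      have *: "(\<lambda>f. poly f t) ` polys F \<subseteq> {poly g t / poly h t | g h. g \<in> polys F \<and> h \<in> polys F}"
      proof
        fix x assume "x \<in> (\<lambda>f. poly f t) ` polys F"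
        then obtain f where "f \<in> polys F" "x = poly f t / poly 1 t" by auto
        moreover have "1 \<in> polys F" by (rule subring_one[OF subring_polys[OF FR]])
        ultimately show "x \<in> {poly g t / poly h t | g h. g \<in> polys F \<and> h \<in> polys F}" by blast
      qed
      show ?thesis
        using padic_field_transcendental[OF F(1) True]
          order_trans[OF F(2) order_trans[OF sup(1) *]] subsetD[OF * sup(2)]
        by (intro exI conjI insert_subsetI)
    qed
  qed
  then show ?thesis using assms that unfolding padic_field_def by meson
qed

subsection \<open>Sequences interpolated by polynomials\<close>

text \<open>A stand-in for an analytic function of \<open>\<pi> * k\<close>: the polynomial may
  change with \<open>n\<close>, so no convergence enters. The factor \<open>\<pi>\<close> makes the
  difference of any two arguments a multiple of \<open>\<pi>\<close>.\<close>

definition interp :: "'a::field_char_0 set \<Rightarrow> 'a \<Rightarrow> (nat \<Rightarrow> 'a) \<Rightarrow> bool" where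
  "interp R \<pi> f \<longleftrightarrow> (\<forall>n. \<exists>Q\<in>polys R. \<forall>k\<le>n. f k = poly Q (\<pi> * of_nat k))"

context
  fixes R :: "'a::field_char_0 set"
  assumes R: "subring_set R"
begin

lemma interp_const: "c \<in> R \<Longrightarrow> interp R \<pi> (\<lambda>_. c)"
  unfolding interp_def by (auto intro!: bexI[of _ "[:c:]"] polys_const[OF R])

lemma interp_add:
  assumes "interp R \<pi> f" "interp R \<pi> g"
  shows "interp R \<pi> (\<lambda>k. f k + g k)"
  unfolding interp_def
proof
  fix n
  obtain P Q where "P \<in> polys R" "Q \<in> polys R" "\<forall>k\<le>n. f k = poly P (\<pi> * of_nat k)"
    "\<forall>k\<le>n. g k = poly Q (\<pi> * of_nat k)"
    using assms unfolding interp_def by blast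
  then show "\<exists>Q\<in>polys R. \<forall>k\<le>n. f k + g k = poly Q (\<pi> * of_nat k)"
    by (intro bexI[of _ "P + Q"] polys_closed[OF R]) auto
qed

lemma interp_mult:
  assumes "interp R \<pi> f" "interp R \<pi> g"
  shows "interp R \<pi> (\<lambda>k. f k * g k)"
  unfolding interp_def
proof
  fix n
  obtain P Q where "P \<in> polys R" "Q \<in> polys R" "\<forall>k\<le>n. f k = poly P (\<pi> * of_nat k)"
    "\<forall>k\<le>n. g k = poly Q (\<pi> * of_nat k)"
    using assms unfolding interp_def by blast
  then show "\<exists>Q\<in>polys R. \<forall>k\<le>n. f k * g k = poly Q (\<pi> * of_nat k)"
    by (intro bexI[of _ "P * Q"] polys_closed[OF R]) auto
qed

lemma interp_sum: "(\<And>i. i \<in> I \<Longrightarrow> interp R \<pi> (f i)) \<Longrightarrow> interp R \<pi> (\<lambda>k. \<Sum>i\<in>I. f i k)"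
  by (induction I rule: infinite_finite_induct)
    (auto intro!: interp_add interp_const subring_zero[OF R])

lemma interp_prod: "(\<And>i. i \<in> I \<Longrightarrow> interp R \<pi> (f i)) \<Longrightarrow> interp R \<pi> (\<lambda>k. \<Prod>i\<in>I. f i k)"
  by (induction I rule: infinite_finite_induct)
    (auto intro!: interp_mult interp_const subring_one[OF R])

lemma interp_values:
  assumes "interp R \<pi> f" "\<pi> \<in> R"
  shows "f k \<in> R"
proof -
  obtain Q where "Q \<in> polys R" "f k = poly Q (\<pi> * of_nat k)"
    using assms(1) unfolding interp_def by blast
  then show ?thesis
    using assms(2) by (auto intro!: poly_in_subring[OF R] subring_mult[OF R] subring_of_nat[OF R])
qed

text \<open>Synthetic division keeps the coefficients in \<open>R\<close>, and since the roots are
  distinct, the remaining ones are still roots of the quotient.\<close>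

lemma polys_split_roots:
  assumes "finite Z" "Q \<in> polys R" "Z \<subseteq> R" "\<forall>z\<in>Z. poly Q z = 0"
  shows "\<exists>S\<in>polys R. Q = (\<Prod>z\<in>Z. [:- z, 1:]) * S"
  using assms
proof (induction Z arbitrary: Q rule: finite_induct)
  case empty
  then show ?case by auto
next
  case (insert z Z)
  define T where "T = synthetic_div Q z"
  have T: "T \<in> polys R" unfolding T_def using insert.prems by (intro synthetic_div_in_polys[OF R]) auto
  have Q: "Q = [:- z, 1:] * T"
    using synthetic_div_correct'[of z Q] insert.prems by (simp add: T_def)
  have "\<forall>y\<in>Z. poly T y = 0"
  proof
    fix y assume y: "y \<in> Z"
    then have "poly Q y = 0" "y \<noteq> z" using insert by auto
    then show "poly T y = 0" by (simp add: Q)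
  qed
  then obtain S where "S \<in> polys R" "T = (\<Prod>z\<in>Z. [:- z, 1:]) * S"
    using insert.IH[OF T] insert.prems by blast
  then show ?case using Q insert.hyps by (intro bexI[of _ S]) (simp_all add: mult_ac)
qed

text \<open>Splitting off \<open>m\<close> roots of the interpolating polynomial makes every value divisible by \<open>\<pi>\<^sup>m\<close>.\<close>

lemma interp_zero:
  assumes f: "interp R \<pi> f" and inf: "infinite {k. f k = 0}" and pi: "\<pi> \<in> R" "\<pi> \<noteq> 0"
    and sep: "\<And>x. (\<And>k. \<exists>y\<in>R. x = \<pi> ^ k * y) \<Longrightarrow> x = 0"
  shows "f y = 0"
proof (rule sep)
  fix m
  obtain Z where Z: "Z \<subseteq> {k. f k = 0}" "finite Z" "card Z = m"
    using infinite_arbitrarily_large[OF inf] by blast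
  \<comment> \<open>The initial segment has to contain \<open>y\<close> together with all the chosen
    zeros.\<close>
  obtain Q where Q: "Q \<in> polys R" "\<forall>k\<le>Max (insert y Z). f k = poly Q (\<pi> * of_nat k)"
    using f unfolding interp_def by blast
  have Qk: "f k = poly Q (\<pi> * of_nat k)" if "k \<in> insert y Z" for k
    using Q(2) Z(2) that by simp
  define W where "W = (\<lambda>k. \<pi> * of_nat k) ` Z"
  have piR: "\<pi> * of_nat k \<in> R" for k
    by (intro subring_mult[OF R] subring_of_nat[OF R] pi)
  have W0: "\<forall>z\<in>W. poly Q z = 0"
    unfolding W_def using Qk Z(1) by fastforce
  obtain S where S: "S \<in> polys R" "Q = (\<Prod>z\<in>W. [:- z, 1:]) * S"
    using polys_split_roots[OF _ Q(1) _ W0] Z(2) piR by (auto simp: W_def)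
  have "f y = poly Q (\<pi> * of_nat y)" using Qk by simp
  also have "\<dots> = (\<Prod>z\<in>W. \<pi> * of_nat y - z) * poly S (\<pi> * of_nat y)"
    by (simp add: S(2) poly_prod)
  also have "(\<Prod>z\<in>W. \<pi> * of_nat y - z) = (\<Prod>k\<in>Z. \<pi> * (of_nat y - of_nat k))"
    unfolding W_def using pi(2)
    by (subst prod.reindex) (auto simp: inj_on_def algebra_simps)
  also have "\<dots> = \<pi> ^ m * (\<Prod>k\<in>Z. of_nat y - of_nat k)"
    by (simp add: prod.distrib Z(3))
  finally have "f y = \<pi> ^ m * ((\<Prod>k\<in>Z. of_nat y - of_nat k) * poly S (\<pi> * of_nat y))"
    by (simp add: mult.assoc)
  moreover have "(\<Prod>k\<in>Z. of_nat y - of_nat k) * poly S (\<pi> * of_nat y) \<in> R"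
    using S(1) piR pi by (intro subring_closed[OF R] poly_in_subring[OF R])
  ultimately show "\<exists>z\<in>R. f y = \<pi> ^ m * z" by blast
qed

text \<open>The product of \<open>l choose j\<close> and \<open>\<pi> ^ (2 * j)\<close> is
  \<open>\<pi> ^ j / fact j\<close> times the product of \<open>\<pi> * l - \<pi> * i\<close> over
  \<open>i < j\<close>. Half of the factors \<open>\<pi>\<close> compensate the factorial and half
  scale the variable; this is why congruences modulo \<open>\<pi>^2\<close> are used.\<close>

lemma interp_binomial_series:
  assumes pi: "\<pi> \<in> R" "\<And>j. \<pi> ^ j / fact j \<in> R" and d: "\<And>j. d j \<in> R"
    and f: "\<And>l. f l = (\<Sum>j\<le>l. of_nat (l choose j) * (\<pi>\<^sup>2) ^ j * d j)"
  shows "interp R \<pi> f"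
  unfolding interp_def
proof
  fix n
  define Q where "Q = (\<Sum>j\<le>n. Polynomial.smult (\<pi> ^ j / fact j * d j) (\<Prod>i<j. [:- (\<pi> * of_nat i), 1:]))"
  have "Q \<in> polys R"
    unfolding Q_def using pi d
    by (intro polys_closed[OF R] subring_closed[OF R] pi(2)) auto
  moreover have "f k = poly Q (\<pi> * of_nat k)" if "k \<le> n" for k
  proof -
    have "poly Q (\<pi> * of_nat k) = (\<Sum>j\<le>n. \<pi> ^ j / fact j * d j * (\<Prod>i<j. \<pi> * (of_nat k - of_nat i)))"
      by (simp add: Q_def poly_sum poly_prod algebra_simps)
    also have "\<dots> = (\<Sum>j\<le>n. of_nat (k choose j) * (\<pi>\<^sup>2) ^ j * d j)"
    proof (rule sum.cong[OF refl])
      fix j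
      have "of_nat (k choose j) = (\<Prod>i<j. of_nat k - of_nat i :: 'a) / fact j"
        by (simp add: binomial_gbinomial gbinomial_prod_rev atLeast0LessThan)
      then show "\<pi> ^ j / fact j * d j * (\<Prod>i<j. \<pi> * (of_nat k - of_nat i)) =
          of_nat (k choose j) * (\<pi>\<^sup>2) ^ j * d j"
        by (simp add: prod.distrib power2_eq_square power_mult_distrib)
    qed
    \<comment> \<open>The binomial coefficient vanishes for \<open>j > k\<close>, so one cut-off at
      \<open>n\<close> serves all \<open>k \<le> n\<close>.\<close>
    also have "\<dots> = (\<Sum>j\<le>k. of_nat (k choose j) * (\<pi>\<^sup>2) ^ j * d j)"
      by (rule sum.mono_neutral_right) (use that in \<open>auto simp: not_le binomial_eq_0\<close>)
    finally show ?thesis by (simp add: f)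
  qed
  ultimately show "\<exists>Q\<in>polys R. \<forall>k\<le>n. f k = poly Q (\<pi> * of_nat k)" by blast
qed

end

text \<open>By assumption \<open>e * f l (Suc j)\<close> is the forward difference of
  \<open>f\<close> in its first argument. The formula is Newton's expansion at 0, that is, the
  binomial formula for the \<open>l\<close>-th power of 1 plus \<open>e\<close> times the shift of
  the second argument.\<close>

lemma newton_forward_difference:
  fixes f :: "nat \<Rightarrow> nat \<Rightarrow> 'a::comm_ring_1"
  assumes "\<And>l j. f (Suc l) j = f l j + e * f l (Suc j)"
  shows "f l i = (\<Sum>j\<le>l. of_nat (l choose j) * e ^ j * f 0 (i + j))"
proof (induction l arbitrary: i)
  case 0
  then show ?case by simp
next
  case (Suc l)
  have *: "(\<Sum>j\<le>l. of_nat (l choose j) * e ^ j * f 0 (i + j)) =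
      f 0 i + (\<Sum>j\<le>l. of_nat (l choose Suc j) * e ^ Suc j * f 0 (i + Suc j))"
  proof -
    have "(\<Sum>j\<le>l. of_nat (l choose j) * e ^ j * f 0 (i + j)) =
        (\<Sum>j\<le>Suc l. of_nat (l choose j) * e ^ j * f 0 (i + j))"
      by (simp add: binomial_eq_0)
    also have "\<dots> = f 0 i + (\<Sum>j\<le>l. of_nat (l choose Suc j) * e ^ Suc j * f 0 (i + Suc j))"
      by (subst sum.atMost_Suc_shift) simp
    finally show ?thesis .
  qed
  have "f (Suc l) i = f l i + e * f l (Suc i)" by (rule assms)
  also have "\<dots> = f 0 i + ((\<Sum>j\<le>l. of_nat (l choose Suc j) * e ^ Suc j * f 0 (i + Suc j))
      + (\<Sum>j\<le>l. of_nat (l choose j) * e ^ Suc j * f 0 (i + Suc j)))"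
    unfolding Suc.IH[of "Suc i"] Suc.IH[of i] * by (simp add: sum_distrib_left mult_ac)
  also have "\<dots> = f 0 i + (\<Sum>j\<le>l. of_nat (Suc l choose Suc j) * e ^ Suc j * f 0 (i + Suc j))"
    by (simp add: algebra_simps flip: sum.distrib)
  also have "\<dots> = (\<Sum>j\<le>Suc l. of_nat (Suc l choose j) * e ^ j * f 0 (i + j))"
    by (subst sum.atMost_Suc_shift) simp
  finally show ?case .
qed

text \<open>Gaussian elimination without division, so that \<open>R\<close> need not be a field.\<close>

lemma functional_descent:
  fixes R :: "'a::idom set" and N :: nat
  assumes R: "subring_set R"
    and "\<forall>w\<in>W. \<forall>i<N. w i \<in> R"
    and "\<And>b. (\<forall>i<N. b i \<in> R) \<Longrightarrow> (\<forall>w\<in>W. (\<Sum>i<N. b i * w i) = 0) \<Longrightarrow> (\<Sum>i<N. b i * v i) = 0"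
    and "\<forall>w\<in>W. (\<Sum>i<N. a i * w i) = 0"
  shows "(\<Sum>i<N. a i * v i) = 0"
  using assms(2-4)
proof (induction N arbitrary: W v)
  case 0
  then show ?case by simp
next
  case (Suc N)
  note cl = subring_closed[OF R]
  show ?case
  proof (cases "\<forall>w\<in>W. w N = 0")
    case True
    \<comment> \<open>The functional that picks out the last coordinate has coefficients in
      \<open>R\<close> and vanishes on \<open>W\<close>.\<close>
    have vN: "v N = 0"
    proof -
      have "(\<Sum>i<Suc N. (if i = N then 1 else 0) * v i) = 0"
        using True by (intro Suc.prems(2)) (auto simp: cl sum.delta)
      then show ?thesis by simp
    qed
    have "(\<Sum>i<N. a i * v i) = 0"
    proof (rule Suc.IH[of W])
      show "\<forall>w\<in>W. \<forall>i<N. w i \<in> R" using Suc.prems(1) by auto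
      show "\<forall>w\<in>W. (\<Sum>i<N. a i * w i) = 0"
      proof
        fix w assume w: "w \<in> W"
        then have "w N = 0" using True by blast
        then show "(\<Sum>i<N. a i * w i) = 0" using Suc.prems(3)[rule_format, OF w] by simp
      qed
      fix b assume b: "\<forall>i<N. b i \<in> R" "\<forall>w\<in>W. (\<Sum>i<N. b i * w i) = 0"
      have "(\<Sum>i<Suc N. (b(N := 0)) i * v i) = 0"
        by (rule Suc.prems(2)) (use b in \<open>auto simp: cl\<close>)
      then show "(\<Sum>i<N. b i * v i) = 0" by simp
    qed
    then show ?thesis using vN by simp
  next
    case False
    then obtain w0 where w0: "w0 \<in> W" "w0 N \<noteq> 0" by blast
    \<comment> \<open>The pivot is \<open>w0\<close>: the last coordinate of \<open>E w\<close> is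
      0, and \<open>E w0\<close> vanishes entirely.\<close>
    define E where "E = (\<lambda>w i. w0 N * w i - w N * w0 i)"
    have E: "(\<Sum>i<N. b i * E w i) = w0 N * (\<Sum>i<N. b i * w i) - w N * (\<Sum>i<N. b i * w0 i)" for b w
      by (simp add: E_def algebra_simps sum_subtractf sum_distrib_left)
    have "(\<Sum>i<N. a i * E v i) = 0"
    proof (rule Suc.IH[of "E ` W"])
      have "E w i \<in> R" if "w \<in> W" "i < N" for w i
        unfolding E_def using Suc.prems(1) w0 that by (intro cl) auto
      then show "\<forall>w\<in>E ` W. \<forall>i<N. w i \<in> R" by blast
      show "\<forall>w\<in>E ` W. (\<Sum>i<N. a i * w i) = 0"
      proof
        fix w' assume "w' \<in> E ` W"
        then obtain w where w: "w \<in> W" "w' = E w" by blast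
        have "(\<Sum>i<N. a i * w i) = - (a N * w N)" "(\<Sum>i<N. a i * w0 i) = - (a N * w0 N)"
          using Suc.prems(3) w w0 by (auto simp: eq_neg_iff_add_eq_0)
        then show "(\<Sum>i<N. a i * w' i) = 0" unfolding w(2) E by (simp add: mult_ac)
      qed
      fix b assume b: "\<forall>i<N. b i \<in> R" "\<forall>w\<in>E ` W. (\<Sum>i<N. b i * w i) = 0"
      \<comment> \<open>The last coefficient is chosen so that \<open>b'\<close> kills
        \<open>w0\<close>; on every \<open>w\<close> it then takes the value of \<open>b\<close> on
        \<open>E w\<close>.\<close>
      define b' where "b' = (\<lambda>i. if i < N then w0 N * b i else - (\<Sum>i<N. b i * w0 i))"
      have b': "(\<Sum>i<Suc N. b' i * w i) = (\<Sum>i<N. b i * E w i)" for w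
        by (simp add: b'_def E sum_distrib_left mult_ac)
      have "(\<Sum>i<Suc N. b' i * v i) = 0"
      proof (rule Suc.prems(2))
        have w0R: "w0 i \<in> R" if "i < Suc N" for i using Suc.prems(1) w0 that by blast
        show "\<forall>i<Suc N. b' i \<in> R"
          unfolding b'_def using b(1) w0R by (auto intro!: cl)
        show "\<forall>w\<in>W. (\<Sum>i<Suc N. b' i * w i) = 0" unfolding b' using b(2) by blast
      qed
      then show "(\<Sum>i<N. b i * E v i) = 0" by (simp only: b')
    qed
    moreover have "(\<Sum>i<N. a i * w0 i) = - (a N * w0 N)"
      using Suc.prems(3) w0 by (auto simp: eq_neg_iff_add_eq_0)
    ultimately have "w0 N * (\<Sum>i<Suc N. a i * v i) = 0" unfolding E by (simp add: algebra_simps)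
    then show ?thesis using w0 by simp
  qed
qed

subsection \<open>Polynomial functions on matrices\<close>

text \<open>These are functions rather than formal polynomials, so that their properties follow by
  induction on how they are generated. \<open>K\<close> is only a set: for \<open>K = {1}\<close>
  the values lie in every subring containing the coordinates.\<close>

inductive_set polyfun :: "'a::field set \<Rightarrow> ('a ^ 'm::finite ^ 'm \<Rightarrow> 'a) set" for K where
  const: "c \<in> K \<Longrightarrow> (\<lambda>_. c) \<in> polyfun K"
| coord: "(\<lambda>A. GL_coord A v) \<in> polyfun K"
| add: "\<phi> \<in> polyfun K \<Longrightarrow> \<psi> \<in> polyfun K \<Longrightarrow> (\<lambda>A. \<phi> A + \<psi> A) \<in> polyfun K"
| mult: "\<phi> \<in> polyfun K \<Longrightarrow> \<psi> \<in> polyfun K \<Longrightarrow> (\<lambda>A. \<phi> A * \<psi> A) \<in> polyfun K"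

lemma polyfun_mono:
  assumes "K \<subseteq> K'" "\<phi> \<in> polyfun K"
  shows "\<phi> \<in> polyfun K'"
  using assms(2) by (induction rule: polyfun.induct) (use assms(1) in \<open>auto intro: polyfun.intros\<close>)

lemma polyfun_entry: "(\<lambda>A. A $ i $ j) \<in> polyfun K"
  using polyfun.coord[of "Some (i, j)" K] by simp

lemma polyfun_sum:
  "0 \<in> K \<Longrightarrow> (\<And>i. i \<in> I \<Longrightarrow> \<phi> i \<in> polyfun K) \<Longrightarrow> (\<lambda>A. \<Sum>i\<in>I. \<phi> i A) \<in> polyfun K"
  by (induction I rule: infinite_finite_induct) (auto intro: polyfun.intros)

lemma polyfun_prod:
  "1 \<in> K \<Longrightarrow> (\<And>i. i \<in> I \<Longrightarrow> \<phi> i \<in> polyfun K) \<Longrightarrow> (\<lambda>A. \<Prod>i\<in>I. \<phi> i A) \<in> polyfun K"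
  by (induction I rule: infinite_finite_induct) (auto intro: polyfun.intros)

text \<open>Arbitrary linear combinations of functions built without coefficients. This isolates the
  coefficients, so that linear algebra can act on them.\<close>

inductive_set polyfun_span :: "('a::field ^ 'm::finite ^ 'm \<Rightarrow> 'a) set" where
  zero: "(\<lambda>_. 0) \<in> polyfun_span"
| step: "\<mu> \<in> polyfun {1} \<Longrightarrow> \<phi> \<in> polyfun_span \<Longrightarrow> (\<lambda>A. c * \<mu> A + \<phi> A) \<in> polyfun_span"

lemma polyfun_span_add: "\<phi> \<in> polyfun_span \<Longrightarrow> \<psi> \<in> polyfun_span \<Longrightarrow> (\<lambda>A. \<phi> A + \<psi> A) \<in> polyfun_span"
  by (induction rule: polyfun_span.induct) (auto simp: add.assoc intro: polyfun_span.step)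

lemma polyfun_span_mult1:
  "\<phi> \<in> polyfun_span \<Longrightarrow> \<mu> \<in> polyfun {1} \<Longrightarrow> (\<lambda>A. c * \<mu> A * \<phi> A) \<in> polyfun_span"
proof (induction rule: polyfun_span.induct)
  case zero
  then show ?case by (simp add: polyfun_span.zero)
next
  case (step \<nu> \<phi> d)
  have "(\<lambda>A. (c * d) * (\<mu> A * \<nu> A) + c * \<mu> A * \<phi> A) \<in> polyfun_span"
    using step by (intro polyfun_span.step polyfun.mult) auto
  then show ?case by (simp add: algebra_simps)
qed

lemma polyfun_span_mult:
  "\<phi> \<in> polyfun_span \<Longrightarrow> \<psi> \<in> polyfun_span \<Longrightarrow> (\<lambda>A. \<phi> A * \<psi> A) \<in> polyfun_span"
proof (induction rule: polyfun_span.induct)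
  case zero
  then show ?case by (simp add: polyfun_span.zero)
next
  case (step \<mu> \<phi> c)
  have "(\<lambda>A. c * \<mu> A * \<psi> A + \<phi> A * \<psi> A) \<in> polyfun_span"
    using step by (intro polyfun_span_add polyfun_span_mult1) auto
  then show ?case by (simp add: algebra_simps)
qed

lemma polyfun_in_span: "\<phi> \<in> polyfun UNIV \<Longrightarrow> \<phi> \<in> polyfun_span"
proof (induction rule: polyfun.induct)
  case (const c)
  have "(\<lambda>_. c * 1 + 0) \<in> polyfun_span"
    by (rule polyfun_span.step[OF polyfun.const polyfun_span.zero]) simp
  then show ?case by simp
next
  case (coord v)
  have "(\<lambda>A. 1 * GL_coord A v + 0) \<in> polyfun_span"
    by (rule polyfun_span.step[OF polyfun.coord polyfun_span.zero])
  then show ?case by simp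
qed (auto intro: polyfun_span_add polyfun_span_mult)

lemma polyfun_expansion:
  fixes \<phi> :: "'a::field ^ 'm::finite ^ 'm \<Rightarrow> 'a"
  assumes "\<phi> \<in> polyfun UNIV"
  shows "\<exists>N a \<mu>. (\<forall>i<N::nat. \<mu> i \<in> polyfun {1}) \<and> \<phi> = (\<lambda>A. \<Sum>i<N. a i * \<mu> i A)"
  using polyfun_in_span[OF assms]
proof (induction rule: polyfun_span.induct)
  case zero
  show ?case by (intro exI[of _ 0]) auto
next
  case (step \<mu> \<phi> c)
  then obtain N a \<nu> where *: "\<forall>i<N::nat. \<nu> i \<in> polyfun {1}" "\<phi> = (\<lambda>A. \<Sum>i<N. a i * \<nu> i A)"
    by blast
  have "(\<lambda>A. c * \<mu> A + \<phi> A) = (\<lambda>A. \<Sum>i<Suc N. (a(N := c)) i * (\<nu>(N := \<mu>)) i A)"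
    by (simp add: *(2) add.commute)
  moreover have "\<forall>i<Suc N. (\<nu>(N := \<mu>)) i \<in> polyfun {1}" using *(1) step by auto
  ultimately show ?case by blast
qed

text \<open>Vanishing on \<open>W\<close> is a system of linear conditions on the coefficients of a
  function, with entries in \<open>R\<close> because the coordinates of \<open>W\<close> lie there.
  Vanishing at \<open>x\<close> is one more linear condition, and \<open>functional_descent\<close>
  passes from coefficients in \<open>R\<close> to arbitrary ones.\<close>

lemma polyfun_descent:
  fixes R :: "'a::field set" and W :: "('a ^ 'm::finite ^ 'm) set"
  assumes R: "subring_set R"
    and W: "\<And>w v. w \<in> W \<Longrightarrow> GL_coord w v \<in> R"
    and x: "\<And>\<psi>. \<psi> \<in> polyfun R \<Longrightarrow> (\<forall>w\<in>W. \<psi> w = 0) \<Longrightarrow> \<psi> x = 0"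
    and \<phi>: "\<phi> \<in> polyfun UNIV" "\<forall>w\<in>W. \<phi> w = 0"
  shows "\<phi> x = 0"
proof -
  obtain N :: nat and a \<mu> where *: "\<forall>i<N. \<mu> i \<in> polyfun {1}" "\<phi> = (\<lambda>A. \<Sum>i<N. a i * \<mu> i A)"
    using polyfun_expansion[OF \<phi>(1)] by blast
  note \<mu> = *(1)[rule_format] fun_cong[OF *(2)]
  have \<mu>R: "\<mu> i \<in> polyfun R" if "i < N" for i
    using polyfun_mono[OF _ \<mu>(1)[OF that], of R] subring_one[OF R] by simp
  have val: "\<psi> w \<in> R" if "\<psi> \<in> polyfun R" "w \<in> W" for \<psi> w
    using that by (induction rule: polyfun.induct) (auto intro: subring_closed[OF R] W)
  have "(\<Sum>i<N. a i * (\<lambda>i. \<mu> i x) i) = 0"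
  proof (rule functional_descent[OF R, of "(\<lambda>w i. \<mu> i w) ` W"])
    show "\<forall>w\<in>(\<lambda>w i. \<mu> i w) ` W. \<forall>i<N. w i \<in> R" using val \<mu>R by blast
    show "\<forall>w\<in>(\<lambda>w i. \<mu> i w) ` W. (\<Sum>i<N. a i * w i) = 0" using \<phi>(2) \<mu>(2) by simp
    fix b assume b: "\<forall>i<N. b i \<in> R" "\<forall>w\<in>(\<lambda>w i. \<mu> i w) ` W. (\<Sum>i<N. b i * w i) = 0"
    have "(\<lambda>A. \<Sum>i<N. b i * \<mu> i A) \<in> polyfun R"
      using b(1) \<mu>R subring_zero[OF R] by (intro polyfun_sum polyfun.mult polyfun.const) auto
    from x[OF this] show "(\<Sum>i<N. b i * \<mu> i x) = 0" using b(2) by simp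
  qed
  then show ?thesis by (simp add: \<mu>(2))
qed

subsection \<open>Powers of a matrix\<close>

lemma GL_simps [simp]:
  "carrier GL = {A. invertible A}" "A \<otimes>\<^bsub>GL\<^esub> B = A ** B" "\<one>\<^bsub>GL\<^esub> = mat 1"
  by (simp_all add: GL_def)

lemma group_GL: "group (GL :: ('a::field ^ 'm::finite ^ 'm) monoid)"
proof (rule groupI)
  fix A :: "'a ^ 'm ^ 'm" assume "A \<in> carrier GL"
  then obtain B where "A ** B = mat 1" "B ** A = mat 1" by (auto simp: invertible_def)
  then show "\<exists>B\<in>carrier GL. B \<otimes>\<^bsub>GL\<^esub> A = \<one>\<^bsub>GL\<^esub>" by (auto simp: invertible_def)
next
  show "\<one>\<^bsub>GL\<^esub> \<in> carrier (GL :: ('a ^ 'm ^ 'm) monoid)"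
    by (auto simp: invertible_def intro: exI[of _ "mat 1"])
qed (auto simp: invertible_mult matrix_mul_assoc)

interpretation GL: group GL
  by (rule group_GL)

definition mats :: "'a set \<Rightarrow> ('a ^ 'm::finite ^ 'm) set" where
  "mats R = {A. \<forall>i j. A $ i $ j \<in> R}"

lemma mats_mult: "subring_set R \<Longrightarrow> A \<in> mats R \<Longrightarrow> B \<in> mats R \<Longrightarrow> A ** B \<in> mats R"
  by (auto simp: mats_def matrix_matrix_mult_def intro!: subring_sum subring_mult)

lemma mats_one: "subring_set R \<Longrightarrow> mat 1 \<in> mats R"
  by (auto simp: mats_def mat_def intro: subring_zero subring_one)

lemma mats_pow: "subring_set R \<Longrightarrow> A \<in> mats R \<Longrightarrow> A [^]\<^bsub>GL\<^esub> (k::nat) \<in> mats R"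
  by (induction k) (auto intro: mats_one mats_mult)

definition smat :: "'a::comm_ring_1 \<Rightarrow> 'a ^ 'm::finite ^ 'm \<Rightarrow> 'a ^ 'm ^ 'm" where
  "smat c A = (\<chi> i j. c * A $ i $ j)"

lemma smat_mult: "A ** smat c B = smat c (A ** B)" "smat c A ** B = smat c (A ** B)"
  by (auto simp: smat_def vec_eq_iff matrix_matrix_mult_def sum_distrib_left mult_ac)

lemma matrix_add_rdistrib: "(A + B) ** C = A ** C + B ** C"
  by (vector matrix_matrix_mult_def sum.distrib[symmetric] distrib_right)

lemma interp_matrix_power:
  fixes h :: "'a::field_char_0 ^ 'm::finite ^ 'm"
  assumes m: "padic_model \<pi> R A" and B: "h = mat 1 + smat (\<pi>\<^sup>2) B" "B \<in> mats R" and h: "invertible h"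
  shows "interp R \<pi> (\<lambda>l. (h [^]\<^bsub>GL\<^esub> l) $ i $ j)"
proof -
  note R = padic_modelD(1)[OF m]
  \<comment> \<open>The second index counts factors \<open>B\<close>, and the form of
    \<open>h\<close> gives the recursion of \<open>newton_forward_difference\<close>. Natural powers
    in \<open>GL\<close> are iterated products, so they also make sense for a singular
    \<open>B\<close>.\<close>
  define f where "f = (\<lambda>l k. (B [^]\<^bsub>GL\<^esub> (k::nat) ** h [^]\<^bsub>GL\<^esub> (l::nat)) $ i $ j)"
  have "f (Suc l) k = f l k + \<pi>\<^sup>2 * f l (Suc k)" for l k
  proof -
    have "h [^]\<^bsub>GL\<^esub> (Suc l) = h ** h [^]\<^bsub>GL\<^esub> l"
      using GL.nat_pow_Suc2[of h l] h by simp
    then have "B [^]\<^bsub>GL\<^esub> k ** h [^]\<^bsub>GL\<^esub> (Suc l) = B [^]\<^bsub>GL\<^esub> k ** h [^]\<^bsub>GL\<^esub> l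
        + smat (\<pi>\<^sup>2) (B [^]\<^bsub>GL\<^esub> (Suc k) ** h [^]\<^bsub>GL\<^esub> l)"
      by (simp add: B(1) matrix_add_ldistrib matrix_add_rdistrib matrix_mul_assoc smat_mult)
    then show ?thesis by (simp add: f_def smat_def del: nat_pow_Suc)
  qed
  then have *: "f l 0 = (\<Sum>k\<le>l. of_nat (l choose k) * (\<pi>\<^sup>2) ^ k * f 0 k)" for l
    using newton_forward_difference[of f "\<pi>\<^sup>2" l 0] by simp
  have "f 0 k \<in> R" for k
    using mats_pow[OF R B(2), of k] by (simp add: f_def mats_def)
  then have "interp R \<pi> (\<lambda>l. f l 0)"
    using * padic_modelD(4,8)[OF m] by (intro interp_binomial_series[OF R]) auto
  then show ?thesis by (simp add: f_def)
qed

text \<open>For the coordinate \<open>inverse (det A)\<close>: the inverse determinant of a power of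
  \<open>h\<close> is the determinant of the same power of \<open>h'\<close>, a polynomial in
  entries that are already interpolated.\<close>

lemma interp_GL_coord_power:
  fixes h :: "'a::field_char_0 ^ 'm::finite ^ 'm"
  assumes m: "padic_model \<pi> R A"
    and B: "h = mat 1 + smat (\<pi>\<^sup>2) B" "B \<in> mats R"
    and B': "h' = mat 1 + smat (\<pi>\<^sup>2) B'" "B' \<in> mats R"
    and h: "h ** h' = mat 1"
  shows "interp R \<pi> (\<lambda>l. GL_coord (h [^]\<^bsub>GL\<^esub> l) v)"
proof -
  note R = padic_modelD(1)[OF m]
  have inv: "invertible h" "invertible h'"
    using h invertible_left_inverse invertible_right_inverse by blast+
  show ?thesis
  proof (cases v)
    case (Some ij)
    then show ?thesis using interp_matrix_power[OF m B inv(1)] by (cases ij) simp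
  next
    case None
    have "inverse (det (h [^]\<^bsub>GL\<^esub> l)) = det (h' [^]\<^bsub>GL\<^esub> l)" for l :: nat
    proof -
      have "det (h [^]\<^bsub>GL\<^esub> l) * det (h' [^]\<^bsub>GL\<^esub> l) = 1"
      proof (induction l)
        case (Suc l)
        have "det h * det h' = 1" using h by (metis det_mul det_I)
        with Suc show ?case by (simp add: det_mul) (metis (no_types, lifting) mult.assoc mult.commute mult.right_neutral)
      qed simp
      then show ?thesis by (rule inverse_unique)
    qed
    moreover have "interp R \<pi> (\<lambda>l. det (h' [^]\<^bsub>GL\<^esub> l))"
      unfolding det_def
      by (intro interp_sum[OF R] interp_mult[OF R] interp_prod[OF R] interp_const[OF R]
          interp_matrix_power[OF m B' inv(2)] subring_of_int[OF R])
    ultimately show ?thesis by (simp add: None)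
  qed
qed

text \<open>For coefficients in \<open>R\<close> the values along the powers of \<open>h\<close> are
  interpolated, and \<open>interp_zero\<close> applies. Arbitrary coefficients follow by descent,
  since all coordinates of the powers lie in \<open>R\<close>.\<close>

lemma polyfun_power_zero:
  fixes h :: "'a::field_char_0 ^ 'm::finite ^ 'm"
  assumes m: "padic_model \<pi> R A"
    and B: "h = mat 1 + smat (\<pi>\<^sup>2) B" "B \<in> mats R"
    and B': "h' = mat 1 + smat (\<pi>\<^sup>2) B'" "B' \<in> mats R"
    and h: "h ** h' = mat 1"
    and \<phi>: "\<phi> \<in> polyfun UNIV" "infinite {l::nat. \<phi> (h [^]\<^bsub>GL\<^esub> l) = 0}"
  shows "\<phi> (h [^]\<^bsub>GL\<^esub> (y::nat)) = 0"
proof -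
  note R = padic_modelD(1)[OF m]
  note coord = interp_GL_coord_power[OF m B B' h]
  define Z where "Z = {l::nat. \<phi> (h [^]\<^bsub>GL\<^esub> l) = 0}"
  have int: "interp R \<pi> (\<lambda>l. \<psi> (h [^]\<^bsub>GL\<^esub> l))" if "\<psi> \<in> polyfun R" for \<psi>
    using that by (induction rule: polyfun.induct)
      (auto intro: interp_const[OF R] interp_add[OF R] interp_mult[OF R] coord)
  show ?thesis
  proof (rule polyfun_descent[OF R _ _ \<phi>(1), of "(\<lambda>l. h [^]\<^bsub>GL\<^esub> l) ` Z"])
    fix w v assume "w \<in> (\<lambda>l. h [^]\<^bsub>GL\<^esub> l) ` Z"
    then show "GL_coord w v \<in> R"
      using interp_values[OF R coord padic_modelD(4)[OF m]] by blast
  next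
    fix \<psi> assume \<psi>: "\<psi> \<in> polyfun R" "\<forall>w\<in>(\<lambda>l. h [^]\<^bsub>GL\<^esub> l) ` Z. \<psi> w = 0"
    then have "Z \<subseteq> {l. \<psi> (h [^]\<^bsub>GL\<^esub> l) = 0}" by auto
    then have "infinite {l::nat. \<psi> (h [^]\<^bsub>GL\<^esub> l) = 0}"
      using \<phi>(2) finite_subset unfolding Z_def by blast
    then show "\<psi> (h [^]\<^bsub>GL\<^esub> y) = 0"
      by (rule interp_zero[OF R int[OF \<psi>(1)] _ padic_modelD(4,5,7)[OF m]])
  qed (auto simp: Z_def)
qed

text \<open>Pigeonhole on residues: two powers of \<open>g\<close> agree entrywise modulo
  \<open>\<pi>^2\<close>, and the smaller one is cancelled by a power of \<open>g'\<close>, whose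
  entries also lie in \<open>A\<close>.\<close>

lemma power_cong_one:
  fixes g :: "'a::field_char_0 ^ 'm::finite ^ 'm"
  assumes m: "padic_model \<pi> R A" and g: "g \<in> mats A" "g' \<in> mats A" "g ** g' = mat 1" "g' ** g = mat 1"
  obtains M B B' where "M \<ge> (1::nat)" "g [^]\<^bsub>GL\<^esub> M = mat 1 + smat (\<pi>\<^sup>2) B" "B \<in> mats R"
    "g' [^]\<^bsub>GL\<^esub> M = mat 1 + smat (\<pi>\<^sup>2) B'" "B' \<in> mats R"
proof -
  note R = padic_modelD(1)[OF m] and A = padic_modelD(2)[OF m]
  have AR: "mats A \<subseteq> mats R" using padic_modelD(3)[OF m] by (auto simp: mats_def)
  have gc: "g \<in> carrier GL" "g' \<in> carrier GL" using g by (auto simp: invertible_def)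
  obtain Q where Q: "finite Q" "\<And>a. a \<in> A \<Longrightarrow> \<exists>q\<in>Q. \<exists>y\<in>R. a = q + \<pi>\<^sup>2 * y"
    using padic_model_finite[OF m] by blast
  then obtain q y where qy: "\<And>a. a \<in> A \<Longrightarrow> q a \<in> Q" "\<And>a. a \<in> A \<Longrightarrow> y a \<in> R"
    "\<And>a. a \<in> A \<Longrightarrow> a = q a + \<pi>\<^sup>2 * y a" by metis
  define F where "F = (\<lambda>k::nat. \<lambda>(i, j). q ((g [^]\<^bsub>GL\<^esub> k) $ i $ j))"
  have gA: "(g [^]\<^bsub>GL\<^esub> (k::nat)) $ i $ j \<in> A" for k i j
    using mats_pow[OF A g(1), of k] by (simp add: mats_def)
  have "range F \<subseteq> (UNIV \<rightarrow>\<^sub>E Q)" using qy(1) gA by (auto simp: F_def)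
  moreover have "finite ((UNIV :: ('m \<times> 'm) set) \<rightarrow>\<^sub>E Q)" by (intro finite_PiE Q) auto
  ultimately have "finite (range F)" by (rule finite_subset)
  then have "\<not> inj F" using finite_imageD infinite_UNIV_nat by blast
  then obtain k1 k2 where "F k1 = F k2" "k1 \<noteq> k2" by (auto simp: inj_def)
  then obtain k l where kl: "F k = F l" "k < l" by (metis nat_neq_iff)
  define M where "M = l - k"
  \<comment> \<open>The difference of the two powers divided by \<open>\<pi>^2\<close>, since their
    representatives in \<open>Q\<close> coincide.\<close>
  define C where "C = (\<chi> i j. y ((g [^]\<^bsub>GL\<^esub> l) $ i $ j) - y ((g [^]\<^bsub>GL\<^esub> k) $ i $ j))"
  have C: "C \<in> mats R" using qy(2) gA by (auto simp: C_def mats_def intro: subring_diff[OF R])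
  have glk: "g [^]\<^bsub>GL\<^esub> l = g [^]\<^bsub>GL\<^esub> k + smat (\<pi>\<^sup>2) C"
  proof -
    have "(g [^]\<^bsub>GL\<^esub> l) $ i $ j = (g [^]\<^bsub>GL\<^esub> k) $ i $ j + \<pi>\<^sup>2 * C $ i $ j" for i j
    proof -
      have "q ((g [^]\<^bsub>GL\<^esub> l) $ i $ j) = q ((g [^]\<^bsub>GL\<^esub> k) $ i $ j)"
        using fun_cong[OF kl(1), of "(i, j)"] by (simp add: F_def)
      then show ?thesis
        using qy(3)[OF gA[of l i j]] qy(3)[OF gA[of k i j]]
          add_diff_cancel_left[of "q ((g [^]\<^bsub>GL\<^esub> k) $ i $ j)" "\<pi>\<^sup>2 * y ((g [^]\<^bsub>GL\<^esub> l) $ i $ j)"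
            "\<pi>\<^sup>2 * y ((g [^]\<^bsub>GL\<^esub> k) $ i $ j)"]
        by (simp add: C_def right_diff_distrib diff_eq_eq add.commute)
    qed
    then show ?thesis by (simp add: vec_eq_iff smat_def)
  qed
  have inv: "g' [^]\<^bsub>GL\<^esub> (n::nat) ** g [^]\<^bsub>GL\<^esub> n = mat 1" for n
  proof (induction n)
    case (Suc n)
    have "g' [^]\<^bsub>GL\<^esub> (Suc n) ** g [^]\<^bsub>GL\<^esub> (Suc n) =
        g' [^]\<^bsub>GL\<^esub> n ** (g' ** g) ** g [^]\<^bsub>GL\<^esub> n"
      using GL.nat_pow_Suc2[OF gc(1), of n] by (simp add: matrix_mul_assoc)
    then show ?case using Suc g(4) by simp
  qed simp
  have "g [^]\<^bsub>GL\<^esub> M = g' [^]\<^bsub>GL\<^esub> k ** g [^]\<^bsub>GL\<^esub> l"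
    using GL.nat_pow_mult[OF gc(1), of k M] kl(2) inv[of k]
    by (simp add: M_def) (metis matrix_mul_assoc matrix_mul_lid)
  also have "\<dots> = mat 1 + smat (\<pi>\<^sup>2) (g' [^]\<^bsub>GL\<^esub> k ** C)"
    by (simp add: glk matrix_add_ldistrib inv smat_mult)
  finally have gM: "g [^]\<^bsub>GL\<^esub> M = mat 1 + smat (\<pi>\<^sup>2) (g' [^]\<^bsub>GL\<^esub> k ** C)" .
  define B where "B = g' [^]\<^bsub>GL\<^esub> k ** C"
  have g'R: "g' [^]\<^bsub>GL\<^esub> (n::nat) \<in> mats R" for n using mats_pow[OF A g(2)] AR by blast
  have BR: "B \<in> mats R" unfolding B_def using C g'R by (intro mats_mult[OF R])
  \<comment> \<open>Multiply the congruence for the \<open>M\<close>-th power of \<open>g\<close> on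
    the left by the \<open>M\<close>-th power of \<open>g'\<close> and solve for the latter.\<close>
  have "g' [^]\<^bsub>GL\<^esub> M = mat 1 + smat (\<pi>\<^sup>2) (smat (-1) (g' [^]\<^bsub>GL\<^esub> M ** B))"
  proof -
    have "mat 1 = g' [^]\<^bsub>GL\<^esub> M + smat (\<pi>\<^sup>2) (g' [^]\<^bsub>GL\<^esub> M ** B)"
      using inv[of M] unfolding gM B_def[symmetric] by (simp add: matrix_add_ldistrib smat_mult)
    then show ?thesis by (simp add: vec_eq_iff smat_def)
  qed
  moreover have "smat (-1) (g' [^]\<^bsub>GL\<^esub> M ** B) \<in> mats R"
    using mats_mult[OF R g'R BR, of M] by (auto simp: smat_def mats_def intro: subring_uminus[OF R])
  ultimately show ?thesis using that[of M B] gM BR kl(2) unfolding B_def M_def by auto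
qed

section \<open>Translations and negative exponents\<close>

lemma polyfun_translate:
  assumes "\<phi> \<in> polyfun UNIV"
  shows "(\<lambda>A. \<phi> (X ** A)) \<in> polyfun UNIV" "(\<lambda>A. \<phi> (A ** X)) \<in> polyfun UNIV"
proof -
  have c: "(\<lambda>A. GL_coord (X ** A) v) \<in> polyfun UNIV" "(\<lambda>A. GL_coord (A ** X) v) \<in> polyfun UNIV" for v
  proof -
    have "(\<lambda>A. inverse (det X) * GL_coord A None) \<in> polyfun UNIV"
      by (intro polyfun.intros) auto
    moreover have "(\<lambda>A. \<Sum>k\<in>UNIV. X $ i $ k * A $ k $ j) \<in> polyfun UNIV"
      "(\<lambda>A. \<Sum>k\<in>UNIV. A $ i $ k * X $ k $ j) \<in> polyfun UNIV" for i j
      by (intro polyfun_sum polyfun.mult polyfun.const polyfun_entry; simp)+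
    ultimately show "(\<lambda>A. GL_coord (X ** A) v) \<in> polyfun UNIV" "(\<lambda>A. GL_coord (A ** X) v) \<in> polyfun UNIV"
      by (atomize (full), cases v)
        (simp add: det_mul mult.commute, auto simp: matrix_matrix_mult_def)
  qed
  show "(\<lambda>A. \<phi> (X ** A)) \<in> polyfun UNIV" "(\<lambda>A. \<phi> (A ** X)) \<in> polyfun UNIV"
    using assms by (induction rule: polyfun.induct) (auto intro: polyfun.intros c)
qed

lemma polyfun_int_power_zero:
  fixes h :: "'a::field_char_0 ^ 'm::finite ^ 'm"
  assumes "invertible h"
    and *: "\<And>\<phi> y. \<phi> \<in> polyfun UNIV \<Longrightarrow> infinite {l::nat. \<phi> (h [^]\<^bsub>GL\<^esub> l) = 0} \<Longrightarrow> \<phi> (h [^]\<^bsub>GL\<^esub> (y::nat)) = 0"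
    and \<phi>: "\<phi> \<in> polyfun UNIV" "infinite {l::nat. \<phi> (h [^]\<^bsub>GL\<^esub> l) = 0}"
  shows "\<phi> (h [^]\<^bsub>GL\<^esub> (y::int)) = 0"
proof -
  have hc: "h \<in> carrier GL" using assms(1) by simp
  \<comment> \<open>Since \<open>y + int c\<close> is nonnegative, translating by the power with
    exponent \<open>- int c\<close> moves \<open>y\<close> to a natural exponent. The translated
    function vanishes at all exponents from \<open>c\<close> on, and these are infinitely
    many.\<close>
  define c where "c = nat (- y)"
  define \<psi> where "\<psi> = (\<lambda>A. \<phi> (h [^]\<^bsub>GL\<^esub> (- int c) ** A))"
  have "\<psi> (h [^]\<^bsub>GL\<^esub> l) = 0" if "l \<ge> c" for l :: nat
  proof -
    have "h [^]\<^bsub>GL\<^esub> (- int c) ** h [^]\<^bsub>GL\<^esub> l = h [^]\<^bsub>GL\<^esub> (l - c)"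
      using GL.int_pow_mult[OF hc, of "- int c" "int l"] that
      by (simp add: int_pow_int flip: of_nat_diff)
    then show ?thesis using *[OF \<phi>] by (simp add: \<psi>_def)
  qed
  then have "{c..} \<subseteq> {l::nat. \<psi> (h [^]\<^bsub>GL\<^esub> l) = 0}" by auto
  then have "infinite {l::nat. \<psi> (h [^]\<^bsub>GL\<^esub> l) = 0}" by (rule infinite_super) (rule infinite_Ici)
  moreover have "\<psi> \<in> polyfun UNIV" unfolding \<psi>_def by (rule polyfun_translate(1)[OF \<phi>(1)])
  ultimately have "\<psi> (h [^]\<^bsub>GL\<^esub> (nat (y + int c))) = 0" by (intro *)
  moreover have "h [^]\<^bsub>GL\<^esub> (- int c) ** h [^]\<^bsub>GL\<^esub> (nat (y + int c)) = h [^]\<^bsub>GL\<^esub> y"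
    using GL.int_pow_mult[OF hc, of "- int c" "y + int c"]
    by (simp add: pow_nat c_def)
  ultimately show ?thesis by (simp add: \<psi>_def)
qed

text \<open>
  The Skolem-Mahler-Lech theorem. The coefficients of \<open>\<phi>\<close> need not lie in the \<open>p\<close>-adic
  model, which is why \<open>M\<close> can be chosen independently of \<open>\<phi>\<close>.
\<close>

theorem polyfun_power_zero_uniform:
  fixes g :: "'a::field_char_0 ^ 'm::finite ^ 'm"
  assumes "invertible g"
  obtains M :: nat where "M \<ge> 1"
    "\<And>\<phi> y. \<phi> \<in> polyfun UNIV \<Longrightarrow> infinite {l::int. \<phi> ((g [^]\<^bsub>GL\<^esub> M) [^]\<^bsub>GL\<^esub> l) = 0} \<Longrightarrow>
      \<phi> ((g [^]\<^bsub>GL\<^esub> M) [^]\<^bsub>GL\<^esub> (y::int)) = 0"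
proof -
  obtain g' where g': "g ** g' = mat 1" "g' ** g = mat 1" using assms by (auto simp: invertible_def)
  define S where "S = range (\<lambda>(i, j). g $ i $ j) \<union> range (\<lambda>(i, j). g' $ i $ j)"
  have "finite S" by (simp add: S_def)
  then obtain \<pi> R A where m: "padic_model \<pi> R A" "S \<subseteq> A" using padic_model_exists by blast
  have "g \<in> mats A" "g' \<in> mats A" using m(2) by (auto simp: mats_def S_def)
  then obtain M B B' where M: "M \<ge> (1::nat)" and
    h: "g [^]\<^bsub>GL\<^esub> M = mat 1 + smat (\<pi>\<^sup>2) B" "B \<in> mats R" and
    h': "g' [^]\<^bsub>GL\<^esub> M = mat 1 + smat (\<pi>\<^sup>2) B'" "B' \<in> mats R"
    using power_cong_one[OF m(1) _ _ g'] by blast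
  have gc: "g \<in> carrier GL" "g' \<in> carrier GL" using g' by (auto simp: invertible_def)
  have inv_g: "inv\<^bsub>GL\<^esub> g = g'" using GL.inv_equality[of g' g] gc g' by simp
  define h1 where "h1 = g [^]\<^bsub>GL\<^esub> M"
  define h2 where "h2 = g' [^]\<^bsub>GL\<^esub> M"
  have hc: "h1 \<in> carrier GL" "h2 \<in> carrier GL" unfolding h1_def h2_def using gc by blast+
  have inv_h: "h2 = inv\<^bsub>GL\<^esub> h1"
    using GL.nat_pow_inv[OF gc(1), of M] by (simp add: h1_def h2_def inv_g)
  have h12: "h1 ** h2 = mat 1" "h2 ** h1 = mat 1"
    using GL.r_inv[OF hc(1)] GL.l_inv[OF hc(1)] inv_h by simp_all
  note z1 = polyfun_power_zero[OF m(1) h[folded h1_def] h'[folded h2_def] h12(1)]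
  note z2 = polyfun_power_zero[OF m(1) h'[folded h2_def] h[folded h1_def] h12(2)]
  have inv12: "invertible h1" "invertible h2" using hc by simp_all
  have "\<phi> (h1 [^]\<^bsub>GL\<^esub> y) = 0"
    if \<phi>: "\<phi> \<in> polyfun UNIV" "infinite {l::int. \<phi> (h1 [^]\<^bsub>GL\<^esub> l) = 0}" for \<phi> and y :: int
  proof -
    have neg: "h2 [^]\<^bsub>GL\<^esub> l = h1 [^]\<^bsub>GL\<^esub> (- l)" for l :: int
      unfolding inv_h GL.int_pow_inv[OF hc(1)] GL.int_pow_neg[OF hc(1)] ..
    define Z1 where "Z1 = {l::nat. \<phi> (h1 [^]\<^bsub>GL\<^esub> l) = 0}"
    define Z2 where "Z2 = {l::nat. \<phi> (h2 [^]\<^bsub>GL\<^esub> l) = 0}"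
    \<comment> \<open>Infinitely many zeros give infinitely many of one sign; nonpositive exponents
      are natural exponents of \<open>h2\<close>, the inverse of \<open>h1\<close>.\<close>
    have "{l::int. \<phi> (h1 [^]\<^bsub>GL\<^esub> l) = 0} \<subseteq> int ` Z1 \<union> (\<lambda>k. - int k) ` Z2"
    proof
      fix l :: int assume l: "l \<in> {l. \<phi> (h1 [^]\<^bsub>GL\<^esub> l) = 0}"
      show "l \<in> int ` Z1 \<union> (\<lambda>k. - int k) ` Z2"
      proof (cases l rule: int_cases2)
        case (nonneg k)
        then show ?thesis using l by (auto simp: Z1_def int_pow_int)
      next
        case (nonpos k)
        then have "k \<in> Z2" using l neg[of "int k"] by (simp add: Z2_def int_pow_int)
        then show ?thesis using nonpos by blast
      qed
    qed
    then have "infinite Z1 \<or> infinite Z2" using \<phi>(2) by (meson finite_UnI finite_imageI finite_subset)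
    then show ?thesis
    proof
      assume "infinite Z1"
      then show ?thesis unfolding Z1_def
        using polyfun_int_power_zero[OF inv12(1) _ \<phi>(1)] z1 by blast
    next
      assume "infinite Z2"
      then have "\<phi> (h2 [^]\<^bsub>GL\<^esub> (- y)) = 0"
        unfolding Z2_def using polyfun_int_power_zero[OF inv12(2) _ \<phi>(1)] z2 by blast
      then show ?thesis using neg[of "- y"] by simp
    qed
  qed
  then show ?thesis using that M unfolding h1_def by blast
qed

subsection \<open>Zariski closure over the algebraic closure\<close>

text \<open>
  Translations by points of \<open>T\<close> are only defined over the algebraic closure, so the closures are
  taken over it; \<open>closure_of_rational\<close> shows that this makes no difference for rational points.
\<close>

definition hull_GL :: "('a::field ^ 'm::finite ^ 'm) set \<Rightarrow> ('a ^ 'm ^ 'm) set" where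
  "hull_GL W = {A. invertible A \<and> (\<forall>\<phi>\<in>polyfun UNIV. (\<forall>w\<in>W. \<phi> w = 0) \<longrightarrow> \<phi> A = 0)}"

lemma hull_GL_invertible: "x \<in> hull_GL W \<Longrightarrow> invertible x"
  by (simp add: hull_GL_def)

lemma hull_GL_vanish: "x \<in> hull_GL W \<Longrightarrow> \<phi> \<in> polyfun UNIV \<Longrightarrow> (\<And>w. w \<in> W \<Longrightarrow> \<phi> w = 0) \<Longrightarrow> \<phi> x = 0"
  by (simp add: hull_GL_def)

lemma hull_GL_superset: "(\<And>w. w \<in> W \<Longrightarrow> invertible w) \<Longrightarrow> W \<subseteq> hull_GL W"
  by (auto simp: hull_GL_def)

lemma hull_GL_mono: "W \<subseteq> W' \<Longrightarrow> hull_GL W \<subseteq> hull_GL W'"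
  by (fastforce simp: hull_GL_def)

lemma hull_GL_least: "W \<subseteq> hull_GL V \<Longrightarrow> hull_GL W \<subseteq> hull_GL V"
  by (fastforce simp: hull_GL_def)

lemma hull_GL_translate:
  assumes "x \<in> hull_GL W" "invertible X"
  shows "X ** x \<in> hull_GL ((**) X ` W)" "x ** X \<in> hull_GL ((\<lambda>A. A ** X) ` W)"
proof -
  have inv: "invertible (X ** x)" "invertible (x ** X)"
    using assms hull_GL_invertible by (auto intro: invertible_mult)
  have "\<phi> (X ** x) = 0" if "\<phi> \<in> polyfun UNIV" "\<forall>w\<in>(**) X ` W. \<phi> w = 0" for \<phi>
    using hull_GL_vanish[OF assms(1) polyfun_translate(1)[OF that(1), of X]] that(2) by auto
  then show "X ** x \<in> hull_GL ((**) X ` W)" using inv by (simp add: hull_GL_def)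
  have "\<phi> (x ** X) = 0" if "\<phi> \<in> polyfun UNIV" "\<forall>w\<in>(\<lambda>A. A ** X) ` W. \<phi> w = 0" for \<phi>
    using hull_GL_vanish[OF assms(1) polyfun_translate(2)[OF that(1), of X]] that(2) by auto
  then show "x ** X \<in> hull_GL ((\<lambda>A. A ** X) ` W)" using inv by (simp add: hull_GL_def)
qed

text \<open>A point outside every closure is detected by the product of functions separating it from
  the individual pieces.\<close>

lemma hull_GL_UN:
  assumes "finite I"
  shows "hull_GL (\<Union>i\<in>I. W i) \<subseteq> (\<Union>i\<in>I. hull_GL (W i))"
proof (rule ccontr)
  assume "\<not> ?thesis"
  then obtain x where x: "x \<in> hull_GL (\<Union>i\<in>I. W i)" "\<And>i. i \<in> I \<Longrightarrow> x \<notin> hull_GL (W i)" by blast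
  then have "\<forall>i\<in>I. \<exists>\<phi>. \<phi> \<in> polyfun UNIV \<and> (\<forall>w\<in>W i. \<phi> w = 0) \<and> \<phi> x \<noteq> 0"
    using hull_GL_invertible[OF x(1)] by (simp add: hull_GL_def Bex_def)
  from bchoice[OF this] obtain \<phi> where
    \<phi>: "\<forall>i\<in>I. \<phi> i \<in> polyfun UNIV \<and> (\<forall>w\<in>W i. \<phi> i w = 0) \<and> \<phi> i x \<noteq> 0" ..
  have "(\<Prod>i\<in>I. \<phi> i x) = 0"
  proof (rule hull_GL_vanish[OF x(1)])
    show "(\<lambda>A. \<Prod>i\<in>I. \<phi> i A) \<in> polyfun UNIV" using \<phi> by (intro polyfun_prod) auto
    show "(\<Prod>i\<in>I. \<phi> i w) = 0" if "w \<in> (\<Union>i\<in>I. W i)" for w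
      using that \<phi> assms by (auto intro!: prod_zero)
  qed
  then show False using \<phi> assms by simp
qed

section \<open>Inversion and closures of subgroups\<close>

lemma polyfun_det:
  assumes "\<And>i j. (\<lambda>A. E A $ i $ j) \<in> polyfun UNIV"
  shows "(\<lambda>A. det (E A)) \<in> polyfun UNIV"
  unfolding det_def
  by (intro polyfun_sum polyfun.mult polyfun.const polyfun_prod assms) auto

text \<open>Inversion is a morphism: Cramer's rule treats the entries, and the inverse determinant
  becomes the determinant.\<close>

lemma polyfun_inverse:
  fixes \<phi> :: "'a::field ^ 'm::finite ^ 'm \<Rightarrow> 'a"
  assumes "\<phi> \<in> polyfun UNIV"
  shows "\<exists>\<psi>\<in>polyfun UNIV. \<forall>A B. A ** B = mat 1 \<longrightarrow> \<psi> A = \<phi> B"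
  using assms
proof (induction rule: polyfun.induct)
  case (const c)
  show ?case by (rule bexI[of _ "\<lambda>_. c"]) (auto intro: polyfun.const)
next
  case (coord v)
  show ?case
  proof (cases v)
    case None
    have "det A = inverse (det B)" if "A ** B = mat 1" for A B :: "'a ^ 'm ^ 'm"
    proof -
      have "det A * det B = 1" using that by (metis det_mul det_I)
      then show ?thesis by (metis inverse_unique inverse_inverse_eq)
    qed
    moreover have "(\<lambda>A. det A) \<in> polyfun UNIV" by (intro polyfun_det polyfun_entry)
    ultimately show ?thesis unfolding None by (intro bexI[of _ det]) auto
  next
    case (Some ij)
    obtain i j where ij: "ij = (i, j)" by (cases ij)
    \<comment> \<open>\<open>E A\<close> is \<open>A\<close> with column \<open>i\<close> replaced
      by the \<open>j\<close>-th unit vector; its determinant divided by that of \<open>A\<close> is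
      the entry \<open>(i, j)\<close> of the inverse.\<close>
    define E :: "'a ^ 'm ^ 'm \<Rightarrow> 'a ^ 'm ^ 'm"
      where "E = (\<lambda>A. \<chi> k l. if l = i then (mat 1 :: 'a ^ 'm ^ 'm) $ k $ j else A $ k $ l)"
    have "inverse (det A) * det (E A) = B $ i $ j" if AB: "A ** B = mat 1" for A B :: "'a ^ 'm ^ 'm"
    proof -
      have "(A *v (\<chi> k. B $ k $ j)) $ k = (mat 1 :: 'a ^ 'm ^ 'm) $ k $ j" for k
        using AB by (auto simp: matrix_vector_mult_def matrix_matrix_mult_def vec_eq_iff)
      then have "E A = (\<chi> k l. if l = i then (A *v (\<chi> k. B $ k $ j)) $ k else A $ k $ l)"
        by (simp add: E_def vec_eq_iff)
      then have "det (E A) = B $ i $ j * det A"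
        using cramer_lemma[of i A "\<chi> k. B $ k $ j"] by simp
      moreover have "det A \<noteq> 0" using AB by (metis det_mul det_I mult_zero_left zero_neq_one)
      ultimately show ?thesis by simp
    qed
    moreover have "(\<lambda>A. inverse (det A) * det (E A)) \<in> polyfun UNIV"
    proof -
      have "(\<lambda>A. E A $ k $ l) \<in> polyfun UNIV" for k l
        by (cases "l = i") (simp_all add: E_def polyfun.const polyfun_entry)
      then have "(\<lambda>A. GL_coord A None * det (E A)) \<in> polyfun UNIV"
        by (intro polyfun.mult polyfun.coord polyfun_det)
      then show ?thesis by simp
    qed
    ultimately show ?thesis unfolding Some ij
      by (intro bexI[of _ "\<lambda>A. inverse (det A) * det (E A)"]) auto
  qed
next
  case (add \<phi>1 \<phi>2)
  then obtain \<psi>1 \<psi>2 where "\<psi>1 \<in> polyfun UNIV" "\<psi>2 \<in> polyfun UNIV"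
    "\<forall>A B. A ** B = mat 1 \<longrightarrow> \<psi>1 A = \<phi>1 B" "\<forall>A B. A ** B = mat 1 \<longrightarrow> \<psi>2 A = \<phi>2 B" by blast
  then show ?case by (intro bexI[of _ "\<lambda>A. \<psi>1 A + \<psi>2 A"] polyfun.add) auto
next
  case (mult \<phi>1 \<phi>2)
  then obtain \<psi>1 \<psi>2 where "\<psi>1 \<in> polyfun UNIV" "\<psi>2 \<in> polyfun UNIV"
    "\<forall>A B. A ** B = mat 1 \<longrightarrow> \<psi>1 A = \<phi>1 B" "\<forall>A B. A ** B = mat 1 \<longrightarrow> \<psi>2 A = \<phi>2 B" by blast
  then show ?case by (intro bexI[of _ "\<lambda>A. \<psi>1 A * \<psi>2 A"] polyfun.mult) auto
qed

lemma hull_GL_subgroup: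
  assumes "subgroup H GL"
  shows "subgroup (hull_GL H) GL"
proof (rule GL.subgroupI)
  have Hc: "invertible x" if "x \<in> H" for x using subgroup.mem_carrier[OF assms that] by simp
  have sup: "H \<subseteq> hull_GL H" by (rule hull_GL_superset[OF Hc])
  show "hull_GL H \<subseteq> carrier GL" by (auto simp: hull_GL_def)
  show "hull_GL H \<noteq> {}" using sup subgroup.one_closed[OF assms] by auto
  fix x assume x: "x \<in> hull_GL H"
  then have xc: "x \<in> carrier GL" by (simp add: hull_GL_invertible)
  have xi: "x ** inv\<^bsub>GL\<^esub> x = mat 1" "invertible (inv\<^bsub>GL\<^esub> x)"
    using GL.r_inv[OF xc] GL.inv_closed[OF xc] by simp_all
  have "\<phi> (inv\<^bsub>GL\<^esub> x) = 0" if \<phi>: "\<phi> \<in> polyfun UNIV" "\<forall>w\<in>H. \<phi> w = 0" for \<phi>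
  proof -
    obtain \<psi> where \<psi>: "\<psi> \<in> polyfun UNIV" "\<forall>A B. A ** B = mat 1 \<longrightarrow> \<psi> A = \<phi> B"
      using polyfun_inverse[OF \<phi>(1)] by blast
    have "\<psi> x = 0"
    proof (rule hull_GL_vanish[OF x \<psi>(1)])
      fix w assume w: "w \<in> H"
      have "w ** inv\<^bsub>GL\<^esub> w = mat 1" using GL.r_inv[of w] Hc[OF w] by simp
      then show "\<psi> w = 0" using \<psi>(2) \<phi>(2) subgroup.m_inv_closed[OF assms w] by metis
    qed
    then show ?thesis using \<psi>(2) xi(1) by metis
  qed
  then show "inv\<^bsub>GL\<^esub> x \<in> hull_GL H" using xi(2) by (simp add: hull_GL_def)
next
  have Hc: "invertible x" if "x \<in> H" for x using subgroup.mem_carrier[OF assms that] by simp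
  fix x y assume xy: "x \<in> hull_GL H" "y \<in> hull_GL H"
  \<comment> \<open>The product is treated one factor at a time: first the left factor ranges over
    \<open>H\<close> only, then translation by \<open>y\<close> extends it to the closure.\<close>
  have "(\<lambda>A. A ** y) ` H \<subseteq> hull_GL H"
  proof
    fix z assume "z \<in> (\<lambda>A. A ** y) ` H"
    then obtain w where w: "w \<in> H" "z = w ** y" by blast
    have "(**) w ` H \<subseteq> H" using subgroup.m_closed[OF assms w(1)] by auto
    then show "z \<in> hull_GL H"
      using hull_GL_translate(1)[OF xy(2) Hc[OF w(1)]] hull_GL_mono w(2) by blast
  qed
  then have "hull_GL ((\<lambda>A. A ** y) ` H) \<subseteq> hull_GL H" by (rule hull_GL_least)
  then show "x \<otimes>\<^bsub>GL\<^esub> y \<in> hull_GL H"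
    using hull_GL_translate(2)[OF xy(1) hull_GL_invertible[OF xy(2)]] by auto
qed

section \<open>Comparison with the topology over the ground field\<close>

lemma peval_polyfun: "(\<lambda>A. peval p (GL_coord A)) \<in> polyfun UNIV"
proof -
  have "(\<lambda>A. GL_coord A v ^ k) \<in> polyfun UNIV" for v k
    by (induction k) (auto intro: polyfun.intros)
  then show ?thesis
    unfolding peval_def by (intro polyfun_sum polyfun.mult polyfun.const polyfun_prod) auto
qed

lemma polyfun_peval:
  fixes \<psi> :: "'l::field alg_closure ^ 'm::finite ^ 'm \<Rightarrow> 'l alg_closure"
  assumes "\<psi> \<in> polyfun (range to_ac)"
  shows "\<exists>p :: (('m \<times> 'm) option, 'l) mpoly. \<forall>A. \<psi> A = peval p (GL_coord A)"
  using assms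
proof (induction rule: polyfun.induct)
  case (const c)
  then obtain a where "c = to_ac a" by blast
  then show ?case by (intro exI[of _ "Poly_Mapping.single 0 a"]) (simp add: peval_single)
next
  case (coord v)
  show ?case
    by (intro exI[of _ "Poly_Mapping.single (Poly_Mapping.single v 1) 1"]) (simp add: peval_single)
next
  case (add \<phi> \<psi>)
  then show ?case by (metis peval_add)
next
  case (mult \<phi> \<psi>)
  then show ?case by (metis peval_mult)
qed

lemma subring_range_to_ac: "subring_set (range to_ac)"
proof (rule subring_setI)
  show "1 \<in> range to_ac" by (metis rangeI to_ac_1)
qed (auto simp flip: to_ac_diff to_ac_mult)

text \<open>Rational points have coordinates in the image of \<open>'l\<close>, so
  \<open>polyfun_descent\<close> reduces functions over the algebraic closure to polynomials over
  \<open>'l\<close>.\<close>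

lemma closure_of_rational:
  fixes T W :: "('l::field alg_closure ^ 'm::finite ^ 'm) set"
  assumes T: "T \<subseteq> carrier GL" and W: "W \<subseteq> rational_points T"
  shows "zariski_GL T closure_of W = T \<inter> hull_GL W"
proof (intro equalityI subsetI)
  have WT: "W \<subseteq> T" using W by (auto simp: rational_points_def)
  fix x assume x: "x \<in> T \<inter> hull_GL W"
  have "closedin (zariski_GL T) (zariski_GL T closure_of W)" by simp
  then obtain P :: "(('m \<times> 'm) option, 'l) mpoly set"
    where P: "zariski_GL T closure_of W = {x \<in> T. \<forall>p\<in>P. peval p (GL_coord x) = 0}"
    unfolding zariski_GL_def closedin_zariski by (rule exE)
  have sub: "W \<subseteq> zariski_GL T closure_of W"
    using WT by (intro closure_of_subset) (simp add: zariski_GL_def)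
  have "peval p (GL_coord x) = 0" if "p \<in> P" for p
  proof (rule hull_GL_vanish[OF _ peval_polyfun])
    show "x \<in> hull_GL W" using x by blast
    show "peval p (GL_coord w) = 0" if "w \<in> W" for w
      using that sub \<open>p \<in> P\<close> unfolding P by blast
  qed
  then show "x \<in> zariski_GL T closure_of W" unfolding P using x by blast
next
  have WT: "W \<subseteq> T" using W by (auto simp: rational_points_def)
  fix x assume x: "x \<in> zariski_GL T closure_of W"
  then have xT: "x \<in> T" using closure_of_subset_topspace[of "zariski_GL T" W] by (auto simp: zariski_GL_def)
  have "\<phi> x = 0" if \<phi>: "\<phi> \<in> polyfun UNIV" "\<forall>w\<in>W. \<phi> w = 0" for \<phi>
  proof (rule polyfun_descent[OF subring_range_to_ac _ _ \<phi>])
    fix w v assume "w \<in> W"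
    then have w: "w $ i $ j \<in> range to_ac" for i j using W by (auto simp: rational_points_def)
    have "det w \<in> range to_ac"
      unfolding det_def by (intro subring_closed[OF subring_range_to_ac] w)
    then have "inverse (det w) \<in> range to_ac" by (auto simp flip: to_ac_inverse)
    then show "GL_coord w v \<in> range to_ac"
      using w by (cases v) auto
  next
    fix \<psi> :: "'l alg_closure ^ 'm ^ 'm \<Rightarrow> 'l alg_closure"
    assume \<psi>: "\<psi> \<in> polyfun (range to_ac)" "\<forall>w\<in>W. \<psi> w = 0"
    obtain p :: "(('m \<times> 'm) option, 'l) mpoly" where p: "\<forall>A. \<psi> A = peval p (GL_coord A)"
      using polyfun_peval[OF \<psi>(1)] by blast
    have "closedin (zariski_GL T) {x \<in> T. \<forall>q\<in>{p}. peval q (GL_coord x) = 0}"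
      unfolding zariski_GL_def closedin_zariski by blast
    moreover have "W \<subseteq> {x \<in> T. \<forall>q\<in>{p}. peval q (GL_coord x) = 0}"
      using WT \<psi>(2) p by auto
    ultimately have "zariski_GL T closure_of W \<subseteq> {x \<in> T. \<forall>q\<in>{p}. peval q (GL_coord x) = 0}"
      by (intro closure_of_minimal)
    then show "\<psi> x = 0" using x p by auto
  qed
  then show "x \<in> T \<inter> hull_GL W" using xT T by (auto simp: hull_GL_def)
qed

lemma hull_GL_subset_closed:
  fixes T W :: "('l::field alg_closure ^ 'm::finite ^ 'm) set"
  assumes T: "closedin (zariski GL_coord (carrier GL)) T" and W: "W \<subseteq> T"
  shows "hull_GL W \<subseteq> T"
proof
  fix x assume x: "x \<in> hull_GL W"
  obtain P :: "(('m \<times> 'm) option, 'l) mpoly set"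
    where P: "T = {x \<in> carrier GL. \<forall>p\<in>P. peval p (GL_coord x) = 0}"
    using T unfolding closedin_zariski by (rule exE)
  have "peval p (GL_coord x) = 0" if "p \<in> P" for p
    by (rule hull_GL_vanish[OF x peval_polyfun]) (use W that in \<open>auto simp: P\<close>)
  then show "x \<in> T" unfolding P using hull_GL_invertible[OF x] by simp
qed

subsection \<open>The closure of a cyclic group\<close>

locale dense_cyclic_group =
  fixes T :: "('l::field_char_0 alg_closure ^ 'm::finite ^ 'm) set" and g :: "'l alg_closure ^ 'm ^ 'm"
  assumes T: "linear_algebraic_group T"
    and g: "invertible g"
    and dense: "zariski_dense (range (\<lambda>n::int. g [^]\<^bsub>GL\<^esub> n)) T"
    and rational: "range (\<lambda>n::int. g [^]\<^bsub>GL\<^esub> n) \<subseteq> rational_points T"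
begin

definition G where "G = range (\<lambda>n::int. g [^]\<^bsub>GL\<^esub> n)"

lemma gc: "g \<in> carrier GL"
  using g by simp

lemma TGL: "T \<subseteq> carrier GL"
  using T by (meson linear_algebraic_group_def subgroup.subset)

lemma GT: "G \<subseteq> T"
  using rational by (auto simp: rational_points_def G_def)

lemma topspace_T [simp]: "topspace (zariski_GL T) = T"
  by (simp add: zariski_GL_def)

lemma pow_mem: "g [^]\<^bsub>GL\<^esub> (n::int) \<in> G"
  by (auto simp: G_def)

lemma pow_inv: "invertible (g [^]\<^bsub>GL\<^esub> (n::int))"
  using GL.int_pow_closed[OF gc] by simp

lemma T_hull: "T = hull_GL G"
proof
  have "zariski_GL T closure_of G = T" using dense by (simp add: zariski_dense_def G_def)
  then show "T \<subseteq> hull_GL G"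
    using closure_of_rational[OF TGL rational] by (auto simp: G_def)
  show "hull_GL G \<subseteq> T"
    using T GT by (intro hull_GL_subset_closed) (simp_all add: linear_algebraic_group_def)
qed

text \<open>The uniform exponent is chosen once, so that \<open>h\<close>, \<open>H\<close> and
  \<open>D\<close> become constants of the locale.\<close>

definition M :: nat where
  "M = (SOME M. M \<ge> 1 \<and> (\<forall>\<phi> y. \<phi> \<in> polyfun UNIV \<longrightarrow>
    infinite {l::int. \<phi> ((g [^]\<^bsub>GL\<^esub> M) [^]\<^bsub>GL\<^esub> l) = 0} \<longrightarrow>
      \<phi> ((g [^]\<^bsub>GL\<^esub> M) [^]\<^bsub>GL\<^esub> (y::int)) = 0))"

lemma M_ex: "M \<ge> 1 \<and> (\<forall>\<phi> y. \<phi> \<in> polyfun UNIV \<longrightarrow>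
    infinite {l::int. \<phi> ((g [^]\<^bsub>GL\<^esub> M) [^]\<^bsub>GL\<^esub> l) = 0} \<longrightarrow>
      \<phi> ((g [^]\<^bsub>GL\<^esub> M) [^]\<^bsub>GL\<^esub> (y::int)) = 0)"
  unfolding M_def
  by (rule someI_ex, rule polyfun_power_zero_uniform[OF g]) (intro exI conjI allI impI)

definition h where "h = g [^]\<^bsub>GL\<^esub> M"

lemma M_pos: "M \<ge> 1"
  using M_ex by blast

lemma h_zero:
  assumes "\<phi> \<in> polyfun UNIV" "infinite {l::int. \<phi> (h [^]\<^bsub>GL\<^esub> l) = 0}"
  shows "\<phi> (h [^]\<^bsub>GL\<^esub> (y::int)) = 0"
  using conjunct2[OF M_ex, rule_format, OF assms[unfolded h_def]] by (simp add: h_def)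

lemma hc: "h \<in> carrier GL"
  unfolding h_def by (rule GL.nat_pow_closed[OF gc])

lemma h_pow: "h [^]\<^bsub>GL\<^esub> (l::int) = g [^]\<^bsub>GL\<^esub> (int M * l)"
  unfolding h_def using GL.int_pow_pow[OF gc, of "int M" l] by (simp add: int_pow_int)

section \<open>The closure of the powers of \<open>h\<close> and its translates\<close>

definition H where "H = range (\<lambda>l::int. h [^]\<^bsub>GL\<^esub> l)"

definition D where "D = hull_GL H"

lemma H_subgroup: "subgroup H GL"
proof (rule GL.subgroupI)
  show "H \<subseteq> carrier GL" unfolding H_def using GL.int_pow_closed[OF hc] by blast
  show "H \<noteq> {}" by (simp add: H_def)
  show "inv\<^bsub>GL\<^esub> x \<in> H" if "x \<in> H" for x
    using that by (auto simp: H_def simp flip: GL.int_pow_neg[OF hc])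
  show "x \<otimes>\<^bsub>GL\<^esub> y \<in> H" if "x \<in> H" "y \<in> H" for x y
    using that by (auto simp: H_def simp del: GL_simps simp flip: GL.int_pow_mult[OF hc])
qed

lemma HG: "H \<subseteq> G"
  by (auto simp: H_def h_pow pow_mem)

lemma D_subgroup: "subgroup D GL"
  unfolding D_def by (rule hull_GL_subgroup[OF H_subgroup])

lemma DT: "D \<subseteq> T"
  unfolding D_def T_hull by (rule hull_GL_mono[OF HG])

lemma HD: "H \<subseteq> D"
  unfolding D_def using subgroup.subset[OF H_subgroup] by (intro hull_GL_superset) auto

lemma one_D: "mat 1 \<in> D"
  using subgroup.one_closed[OF D_subgroup] by simp

definition coset :: "int \<Rightarrow> ('l alg_closure ^ 'm ^ 'm) set" where
  "coset k = (**) (g [^]\<^bsub>GL\<^esub> k) ` D"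

lemma pow_mult: "g [^]\<^bsub>GL\<^esub> (i::int) ** g [^]\<^bsub>GL\<^esub> j = g [^]\<^bsub>GL\<^esub> (i + j)"
  using GL.int_pow_mult[OF gc, of i j] by simp

lemma pow_0: "g [^]\<^bsub>GL\<^esub> (0::int) = mat 1"
  by (simp add: int_pow_def2)

lemma coset_eq_hull: "coset k = hull_GL ((**) (g [^]\<^bsub>GL\<^esub> k) ` H)"
proof
  show "coset k \<subseteq> hull_GL ((**) (g [^]\<^bsub>GL\<^esub> k) ` H)"
    unfolding coset_def D_def using hull_GL_translate(1)[OF _ pow_inv] by blast
  show "hull_GL ((**) (g [^]\<^bsub>GL\<^esub> k) ` H) \<subseteq> coset k"
  proof
    fix x assume "x \<in> hull_GL ((**) (g [^]\<^bsub>GL\<^esub> k) ` H)"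
    from hull_GL_translate(1)[OF this pow_inv[of "- k"]]
    have "g [^]\<^bsub>GL\<^esub> (- k) ** x \<in> D"
      unfolding D_def by (simp add: image_image matrix_mul_assoc pow_mult pow_0)
    moreover have "x = g [^]\<^bsub>GL\<^esub> k ** (g [^]\<^bsub>GL\<^esub> (- k) ** x)"
      by (simp add: matrix_mul_assoc pow_mult pow_0)
    ultimately show "x \<in> coset k" unfolding coset_def by blast
  qed
qed

lemma coset_G: "(**) (g [^]\<^bsub>GL\<^esub> (k::int)) ` H \<subseteq> G"
  by (auto simp: H_def h_pow pow_mult pow_mem)

lemma coset_T: "coset k \<subseteq> T"
  unfolding coset_eq_hull T_hull by (rule hull_GL_mono[OF coset_G])

lemma G_split: "g [^]\<^bsub>GL\<^esub> (n::int) = g [^]\<^bsub>GL\<^esub> (n mod int M) ** h [^]\<^bsub>GL\<^esub> (n div int M)"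
  by (simp add: h_pow pow_mult)

text \<open>Dividing exponents by \<open>M\<close> splits \<open>G\<close> into finitely many
  translates of \<open>H\<close>, and closures of finite unions are covered by the closures of the
  pieces.\<close>

lemma T_cover: "T = (\<Union>k\<in>{0..<int M}. coset k)"
proof
  have "G \<subseteq> (\<Union>k\<in>{0..<int M}. (**) (g [^]\<^bsub>GL\<^esub> k) ` H)"
  proof
    fix x assume "x \<in> G"
    then obtain n :: int where n: "x = g [^]\<^bsub>GL\<^esub> n" by (auto simp: G_def)
    have "n mod int M \<in> {0..<int M}" using M_pos by simp
    moreover have "h [^]\<^bsub>GL\<^esub> (n div int M) \<in> H" by (simp add: H_def)
    ultimately show "x \<in> (\<Union>k\<in>{0..<int M}. (**) (g [^]\<^bsub>GL\<^esub> k) ` H)"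
      unfolding n G_split[of n] by blast
  qed
  then have "T \<subseteq> hull_GL (\<Union>k\<in>{0..<int M}. (**) (g [^]\<^bsub>GL\<^esub> k) ` H)"
    unfolding T_hull by (rule hull_GL_mono)
  also have "\<dots> \<subseteq> (\<Union>k\<in>{0..<int M}. hull_GL ((**) (g [^]\<^bsub>GL\<^esub> k) ` H))"
    by (rule hull_GL_UN) simp
  finally show "T \<subseteq> (\<Union>k\<in>{0..<int M}. coset k)" unfolding coset_eq_hull .
  show "(\<Union>k\<in>{0..<int M}. coset k) \<subseteq> T" using coset_T by blast
qed

text \<open>A coset is the closure of a set of rational points, so taking the closure over the
  ground field gives the same set.\<close>

lemma coset_closed: "closedin (zariski_GL T) (coset k)"
proof -
  have "(**) (g [^]\<^bsub>GL\<^esub> k) ` H \<subseteq> rational_points T" using coset_G rational by (auto simp: G_def)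
  from closure_of_rational[OF TGL this]
  have "zariski_GL T closure_of ((**) (g [^]\<^bsub>GL\<^esub> k) ` H) = coset k"
    using coset_T[of k] unfolding coset_eq_hull by blast
  then show ?thesis using closedin_closure_of by metis
qed

lemma coset_subset:
  assumes "x \<in> coset i" "x \<in> coset j"
  shows "coset i \<subseteq> coset j"
proof
  obtain a where a: "a \<in> D" "x = g [^]\<^bsub>GL\<^esub> i ** a" using assms by (auto simp: coset_def)
  obtain b where b: "b \<in> D" "x = g [^]\<^bsub>GL\<^esub> j ** b" using assms by (auto simp: coset_def)
  define a' where "a' = inv\<^bsub>GL\<^esub> a"
  have ac: "a \<in> carrier GL" by (rule subgroup.mem_carrier[OF D_subgroup a(1)])
  have a': "a' \<in> D" "a ** a' = mat 1"
    unfolding a'_def using subgroup.m_inv_closed[OF D_subgroup a(1)] GL.r_inv[OF ac] by simp_all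
  fix y assume "y \<in> coset i"
  then obtain d where d: "d \<in> D" "y = g [^]\<^bsub>GL\<^esub> i ** d" by (auto simp: coset_def)
  have "y = g [^]\<^bsub>GL\<^esub> i ** (a ** a') ** d" by (simp add: d a')
  also have "\<dots> = x ** a' ** d" by (simp add: a(2) matrix_mul_assoc)
  also have "\<dots> = g [^]\<^bsub>GL\<^esub> j ** (b ** a' ** d)" by (simp add: b(2) matrix_mul_assoc)
  finally have "y = g [^]\<^bsub>GL\<^esub> j ** (b ** a' ** d)" .
  moreover have "b ** a' ** d \<in> D"
    using subgroup.m_closed[OF D_subgroup subgroup.m_closed[OF D_subgroup b(1) a'(1)] d(1)] by simp
  ultimately show "y \<in> coset j" unfolding coset_def by blast
qed

text \<open>Cosets that meet coincide, so the complement is a finite union of closed cosets.\<close>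

lemma coset_open: "openin (zariski_GL T) (coset k)"
proof -
  define I where "I = {i \<in> {0..<int M}. coset i \<inter> coset k = {}}"
  have "finite I" unfolding I_def by (rule finite_subset[of _ "{0..<int M}"]) auto
  have "T - coset k = (\<Union>i\<in>I. coset i)"
  proof
    show "T - coset k \<subseteq> (\<Union>i\<in>I. coset i)"
    proof
      fix x assume x: "x \<in> T - coset k"
      then obtain i where i: "i \<in> {0..<int M}" "x \<in> coset i" using T_cover by blast
      have "coset i \<inter> coset k = {}" using coset_subset[of _ i k] i x by blast
      then show "x \<in> (\<Union>i\<in>I. coset i)" using i unfolding I_def by blast
    qed
    show "(\<Union>i\<in>I. coset i) \<subseteq> T - coset k" using coset_T unfolding I_def by blast
  qed
  moreover have "closedin (zariski_GL T) (\<Union>i\<in>I. coset i)"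
    using coset_closed \<open>finite I\<close> by (intro closedin_Union) auto
  ultimately show ?thesis using coset_T[of k] by (simp add: openin_closedin)
qed

lemma D_coset: "D = coset 0"
  by (simp add: coset_def pow_0)

text \<open>The argument is one for irreducibility: if at each point of \<open>D\<close> one of two
  functions vanishes, then one of them vanishes at infinitely many powers of \<open>h\<close>, hence
  on \<open>D\<close>.\<close>

lemma D_connected: "connectedin (zariski_GL T) D"
  unfolding connectedin
proof (intro conjI notI)
  show "D \<subseteq> topspace (zariski_GL T)" using DT by simp
  assume "\<exists>E1 E2. openin (zariski_GL T) E1 \<and> openin (zariski_GL T) E2 \<and> D \<subseteq> E1 \<union> E2 \<and>
    E1 \<inter> E2 \<inter> D = {} \<and> E1 \<inter> D \<noteq> {} \<and> E2 \<inter> D \<noteq> {}"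
  then obtain E1 E2 where E: "openin (zariski_GL T) E1" "openin (zariski_GL T) E2"
    "E1 \<inter> E2 \<inter> D = {}" "E1 \<inter> D \<noteq> {}" "E2 \<inter> D \<noteq> {}" by blast
  \<comment> \<open>One of the polynomials defining the complement of \<open>E\<close> is nonzero at
    a point of \<open>D\<close>.\<close>
  have *: "\<exists>\<phi>\<in>polyfun UNIV. (\<forall>x\<in>D - E. \<phi> x = 0) \<and> (\<exists>x\<in>D. \<phi> x \<noteq> 0)"
    if E: "openin (zariski_GL T) E" "E \<inter> D \<noteq> {}" for E
  proof -
    from E(1) obtain P :: "(('m \<times> 'm) option, 'l) mpoly set"
      where P: "\<forall>x. x \<in> E \<longleftrightarrow> x \<in> T \<and> (\<exists>p\<in>P. peval p (GL_coord x) \<noteq> 0)"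
      unfolding zariski_GL_def openin_zariski zariski_open_iff by (rule exE)
    obtain x where x: "x \<in> E" "x \<in> D" using E(2) by blast
    then obtain p where "p \<in> P" "peval p (GL_coord x) \<noteq> 0" using P by blast
    moreover have "peval p (GL_coord y) = 0" if "y \<in> D - E" for y
      using that P \<open>p \<in> P\<close> DT by blast
    ultimately show ?thesis using x(2) peval_polyfun[of p]
      by (intro bexI[of _ "\<lambda>A. peval p (GL_coord A)"]) auto
  qed
  obtain \<phi>1 where \<phi>1: "\<phi>1 \<in> polyfun UNIV" "\<forall>x\<in>D - E1. \<phi>1 x = 0" "\<exists>x\<in>D. \<phi>1 x \<noteq> 0"
    using *[OF E(1,4)] by blast
  obtain \<phi>2 where \<phi>2: "\<phi>2 \<in> polyfun UNIV" "\<forall>x\<in>D - E2. \<phi>2 x = 0" "\<exists>x\<in>D. \<phi>2 x \<noteq> 0"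
    using *[OF E(2,5)] by blast
  have "\<phi>1 x = 0 \<or> \<phi>2 x = 0" if "x \<in> D" for x using \<phi>1(2) \<phi>2(2) E(3) that by blast
  then have "UNIV = {l::int. \<phi>1 (h [^]\<^bsub>GL\<^esub> l) = 0} \<union> {l::int. \<phi>2 (h [^]\<^bsub>GL\<^esub> l) = 0}"
    using HD unfolding H_def by blast
  then have "infinite {l::int. \<phi>1 (h [^]\<^bsub>GL\<^esub> l) = 0} \<or> infinite {l::int. \<phi>2 (h [^]\<^bsub>GL\<^esub> l) = 0}"
    using infinite_UNIV_int by (metis finite_UnI)
  then show False
  proof
    assume "infinite {l::int. \<phi>1 (h [^]\<^bsub>GL\<^esub> l) = 0}"
    then have "\<phi>1 w = 0" if "w \<in> H" for w using h_zero[OF \<phi>1(1)] that by (auto simp: H_def)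
    then have "\<phi>1 x = 0" if "x \<in> D" for x using hull_GL_vanish[OF _ \<phi>1(1)] that unfolding D_def by blast
    then show False using \<phi>1(3) by blast
  next
    assume "infinite {l::int. \<phi>2 (h [^]\<^bsub>GL\<^esub> l) = 0}"
    then have "\<phi>2 w = 0" if "w \<in> H" for w using h_zero[OF \<phi>2(1)] that by (auto simp: H_def)
    then have "\<phi>2 x = 0" if "x \<in> D" for x using hull_GL_vanish[OF _ \<phi>2(1)] that unfolding D_def by blast
    then show False using \<phi>2(3) by blast
  qed
qed

text \<open>\<open>D\<close> is connected and contains the identity; being open and closed, it
  contains every connected set that it meets.\<close>

lemma identity_component_eq: "identity_component T = D"
proof
  let ?C = "connected_component_of_set (zariski_GL T) (mat 1)"
  show "D \<subseteq> identity_component T"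
    unfolding identity_component_def by (rule connected_component_of_maximal[OF D_connected one_D])
  have "mat 1 \<in> ?C" using one_D DT by (simp add: connected_component_of_refl subsetD)
  moreover have "?C \<subseteq> D \<or> disjnt ?C D"
    using connectedin_clopen_cases[OF connectedin_connected_component_of coset_closed coset_open, of _ 0]
    by (simp add: D_coset)
  ultimately show "identity_component T \<subseteq> D"
    unfolding identity_component_def disjnt_def using one_D by blast
qed

lemma infinite_subset_dense:
  assumes Tc: "Tc \<in> connected_components_of (zariski_GL T)"
    and S: "S \<subseteq> G \<inter> Tc" "infinite S"
  shows "zariski_dense S Tc"
proof -
  have TcT: "Tc \<subseteq> T" using connected_components_of_subset[OF Tc] by simp
  have "S \<subseteq> rational_points Tc"
    using S(1) rational[folded G_def] unfolding rational_points_def by blast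
  then have cl: "zariski_GL Tc closure_of S = Tc \<inter> hull_GL S"
    using TcT TGL by (intro closure_of_rational) auto
  \<comment> \<open>Exponents of the members of \<open>S\<close> in the \<open>k\<close>-th coset.
    Finitely many \<open>k\<close> account for all of \<open>S\<close>, so some \<open>Z k\<close>
    is infinite.\<close>
  define Z where "Z = (\<lambda>k::int. {l::int. g [^]\<^bsub>GL\<^esub> k ** h [^]\<^bsub>GL\<^esub> l \<in> S})"
  have "S \<subseteq> (\<Union>k\<in>{0..<int M}. (\<lambda>l. g [^]\<^bsub>GL\<^esub> k ** h [^]\<^bsub>GL\<^esub> l) ` Z k)"
  proof
    fix x assume x: "x \<in> S"
    then obtain n :: int where n: "x = g [^]\<^bsub>GL\<^esub> n" using S(1) by (auto simp: G_def)
    have "n mod int M \<in> {0..<int M}" using M_pos by simp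
    moreover have "n div int M \<in> Z (n mod int M)" using x unfolding Z_def n G_split[of n] by simp
    ultimately show "x \<in> (\<Union>k\<in>{0..<int M}. (\<lambda>l. g [^]\<^bsub>GL\<^esub> k ** h [^]\<^bsub>GL\<^esub> l) ` Z k)"
      unfolding n G_split[of n] by blast
  qed
  then have "\<exists>k. infinite (Z k)" using S(2)
    by (meson finite_UN_I finite_atLeastLessThan_int finite_imageI finite_subset)
  then obtain k where k: "infinite (Z k)" ..
  have "\<phi> x = 0" if \<phi>: "\<phi> \<in> polyfun UNIV" "\<And>w. w \<in> S \<Longrightarrow> \<phi> w = 0" and x: "x \<in> coset k" for \<phi> x
  proof -
    define \<psi> where "\<psi> = (\<lambda>A. \<phi> (g [^]\<^bsub>GL\<^esub> k ** A))"
    have \<psi>: "\<psi> \<in> polyfun UNIV" unfolding \<psi>_def by (rule polyfun_translate(1)[OF \<phi>(1)])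
    have "Z k \<subseteq> {l. \<psi> (h [^]\<^bsub>GL\<^esub> l) = 0}" using \<phi>(2) by (auto simp: Z_def \<psi>_def)
    then have "infinite {l::int. \<psi> (h [^]\<^bsub>GL\<^esub> l) = 0}" using k by (rule infinite_super)
    then have "\<psi> w = 0" if "w \<in> H" for w using h_zero[OF \<psi>] that by (auto simp: H_def)
    moreover obtain d where d: "d \<in> D" "x = g [^]\<^bsub>GL\<^esub> k ** d" using x by (auto simp: coset_def)
    ultimately have "\<psi> d = 0" using hull_GL_vanish[OF d(1)[unfolded D_def] \<psi>] by blast
    then show ?thesis by (simp add: \<psi>_def d)
  qed
  then have hull: "coset k \<subseteq> hull_GL S" using order_trans[OF coset_T[of k] TGL] by (auto simp: hull_GL_def)
  obtain l where l: "l \<in> Z k" using k by fastforce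
  define s where "s = g [^]\<^bsub>GL\<^esub> k ** h [^]\<^bsub>GL\<^esub> l"
  have "s \<in> Tc" using l S(1) by (auto simp: s_def Z_def)
  moreover have "s \<in> coset k" using HD unfolding s_def coset_def H_def by blast
  ultimately have "\<not> disjnt Tc (coset k)" by (auto simp: disjnt_def)
  \<comment> \<open>A connected set meeting an open and closed coset lies inside it, hence inside
    the closure of \<open>S\<close>.\<close>
  then have "Tc \<subseteq> coset k"
    using connectedin_clopen_cases[OF connectedin_connected_components_of[OF Tc] coset_closed coset_open, of k]
    by blast
  then show ?thesis using hull S(1) cl by (auto simp: zariski_dense_def)
qed

text \<open>
  A linear relation between the additive coordinates of \<open>h\<close> holds on all powers of \<open>h\<close>, hence
  on the whole identity component.
\<close>

lemma additive_dim_le_1: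
  assumes "isomorphic_to_Gm_Ga (identity_component T) r n"
  shows "n = 0 \<or> n = 1"
proof (rule ccontr)
  assume "\<not> ?thesis"
  then have n: "0 < n" "1 < n" by auto
  obtain f where f: "algebraic_group_iso GL_coord (GL_on D) (Gm_Ga_coord r n) (Gm_Ga r n) f"
    using assms unfolding isomorphic_to_Gm_Ga_def identity_component_eq by blast
  then have iso: "f \<in> iso (GL_on D) (Gm_Ga r n)"
    and mor: "variety_morphism GL_coord D (Gm_Ga_coord r n) (carrier (Gm_Ga r n)) f"
    by (simp_all add: algebraic_group_iso_def)
  define Y where "Y = (\<lambda>j x. snd (f x) j)"
  have hom: "f (x ** y) = f x \<otimes>\<^bsub>Gm_Ga r n\<^esub> f y" if "x \<in> D" "y \<in> D" for x y
    using iso that by (simp add: iso_def hom_def)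
  have Y_add: "Y j (x ** y) = Y j x + Y j y" if "x \<in> D" "y \<in> D" "j < n" for j x y
    using that by (simp add: Y_def hom Gm_Ga_def mult_DirProd' Ga_def)
  have Y_poly: "\<exists>p. \<forall>x\<in>D. Y j x = peval p (GL_coord x)" if "j < n" for j
  proof -
    have "Gm_Ga_coord r n (f x) (Add j) = Y j x" for x
      using that by (cases "f x") (simp add: Y_def)
    moreover have "regular_function GL_coord D (\<lambda>x. Gm_Ga_coord r n (f x) (Add j))"
      using mor by (simp add: variety_morphism_def)
    ultimately show ?thesis by (simp add: regular_function_def)
  qed
  obtain p0 where p0: "\<forall>x\<in>D. Y 0 x = peval p0 (GL_coord x)" using Y_poly[OF n(1)] by blast
  obtain p1 where p1: "\<forall>x\<in>D. Y 1 x = peval p1 (GL_coord x)" using Y_poly[OF n(2)] by blast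
  have hD: "h [^]\<^bsub>GL\<^esub> (l::int) \<in> D" for l using HD by (auto simp: H_def)
  have relation: "a * Y 0 x + b * Y 1 x = 0" if ab: "a * Y 0 h + b * Y 1 h = 0" and x: "x \<in> D" for a b x
  proof -
    define \<psi> where "\<psi> = (\<lambda>A. a * peval p0 (GL_coord A) + b * peval p1 (GL_coord A))"
    have \<psi>: "\<psi> \<in> polyfun UNIV"
      unfolding \<psi>_def by (intro polyfun.add polyfun.mult polyfun.const peval_polyfun) auto
    have \<psi>Y: "\<psi> x = a * Y 0 x + b * Y 1 x" if "x \<in> D" for x
      using that p0 p1 by (simp add: \<psi>_def)
    have hD1: "h \<in> D" using hD[of 1] GL.int_pow_1[OF hc] by simp
    \<comment> \<open>The induction starts at exponent 1, where the claim is the assumed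
      relation.\<close>
    have "\<psi> (h [^]\<^bsub>GL\<^esub> (Suc l)) = 0" for l :: nat
    proof (induction l)
      case 0
      show ?case using \<psi>Y[OF hD1] ab by simp
    next
      case (Suc l)
      have l: "h [^]\<^bsub>GL\<^esub> (Suc l) \<in> D" using hD[of "int (Suc l)"] by (simp only: int_pow_int)
      have l': "h [^]\<^bsub>GL\<^esub> (Suc l) ** h \<in> D" using hD[of "int (Suc (Suc l))"] by (simp only: int_pow_int nat_pow_Suc GL_simps)
      have "\<psi> (h [^]\<^bsub>GL\<^esub> (Suc l) ** h) = \<psi> (h [^]\<^bsub>GL\<^esub> (Suc l)) + \<psi> h"
        using Y_add[OF l hD1 n(1)] Y_add[OF l hD1 n(2)]
        by (simp only: \<psi>Y[OF l] \<psi>Y[OF l'] \<psi>Y[OF hD1]) (simp add: algebra_simps)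
      then show ?case using Suc \<psi>Y[OF hD1] ab by simp
    qed
    then have "range (\<lambda>l. int (Suc l)) \<subseteq> {l::int. \<psi> (h [^]\<^bsub>GL\<^esub> l) = 0}"
      by (auto simp only: int_pow_int image_subset_iff mem_Collect_eq)
    moreover have "infinite (range (\<lambda>l. int (Suc l)))"
      by (rule range_inj_infinite) (simp add: inj_def)
    ultimately have "infinite {l::int. \<psi> (h [^]\<^bsub>GL\<^esub> l) = 0}" by (rule infinite_super)
    then have "\<psi> w = 0" if "w \<in> H" for w using h_zero[OF \<psi>] that by (auto simp: H_def)
    then have "\<psi> x = 0" using hull_GL_vanish[OF x[unfolded D_def] \<psi>] by blast
    then show ?thesis using \<psi>Y[OF x] by simp
  qed
  \<comment> \<open>The isomorphism is onto, so the additive coordinates take arbitrary values on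
    \<open>D\<close>; a linear relation valid on \<open>D\<close> must have zero
    coefficients.\<close>
  have surj: "\<exists>x\<in>D. \<forall>j<n. Y j x = c j" for c :: "nat \<Rightarrow> 'l alg_closure"
  proof -
    have "((\<lambda>i\<in>{..<r}. 1), (\<lambda>j\<in>{..<n}. c j)) \<in> carrier (Gm_Ga r n)"
      by (auto simp: Gm_Ga_def Gm_def Ga_def)
    moreover have "f ` D = carrier (Gm_Ga r n)"
      using iso by (simp add: iso_def bij_betw_def)
    ultimately obtain x where "x \<in> D" "f x = ((\<lambda>i\<in>{..<r}. 1), (\<lambda>j\<in>{..<n}. c j))"
      by (metis (no_types, lifting) imageE)
    then show ?thesis by (intro bexI[of _ x]) (auto simp: Y_def)
  qed
  have trivial: "a = 0 \<and> b = 0" if ab: "a * Y 0 h + b * Y 1 h = 0" for a b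
  proof -
    obtain x where "x \<in> D" "\<forall>j<n. Y j x = (if j = 0 then 1 else 0)"
      using surj[of "\<lambda>j. if j = 0 then 1 else 0"] by blast
    then have "a = 0" using relation[OF ab, of x] n by simp
    moreover obtain y where "y \<in> D" "\<forall>j<n. Y j y = (if j = 1 then 1 else 0)"
      using surj[of "\<lambda>j. if j = 1 then 1 else 0"] by blast
    then have "b = 0" using relation[OF ab, of y] n by simp
    ultimately show ?thesis ..
  qed
  \<comment> \<open>This relation at \<open>h\<close> holds by commutativity and forces both
    coordinates of \<open>h\<close> to vanish. Then even the relation with coefficients 1 and 0
    holds at \<open>h\<close>, which is absurd.\<close>
  have "Y 1 h * Y 0 h + (- Y 0 h) * Y 1 h = 0" by simp
  from trivial[OF this] have "Y 1 h = 0" "Y 0 h = 0" by auto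
  then have "1 * Y 0 h + 0 * Y 1 h = 0" by simp
  from trivial[OF this] show False by simp
qed

end

theorem theorem7p4:
  fixes T G :: "('l::field_char_0 alg_closure ^ 'm::finite ^ 'm) set"
    and r n :: nat
  assumes "linear_algebraic_group T"
    and "comm_group (GL_on T)"
    and "isomorphic_to_Gm_Ga (identity_component T) r n"
    and "subgroup G (GL_on T)"
    and "G \<subseteq> rational_points T"
    and "cyclic_group (GL_on G)"
    and "infinite G"
    and "zariski_dense G T"
  shows "(n = 0 \<or> n = 1) \<and>
    (\<forall>Tc \<in> connected_components_of (zariski_GL T).
      \<forall>S. S \<subseteq> G \<inter> Tc \<and> infinite S \<longrightarrow> zariski_dense S Tc)"
proof -
  have "subgroup T GL" using assms(1) by (simp add: linear_algebraic_group_def)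
  then have G: "subgroup G GL" using assms(4) GL.incl_subgroup by blast
  interpret GG: group "GL_on G" by (rule GL.subgroup_imp_group[OF G])
  obtain g where g: "g \<in> G" "G = range (\<lambda>n::int. g [^]\<^bsub>GL_on G\<^esub> n)"
    using assms(6) GG.cyclic_group by auto
  have "g [^]\<^bsub>GL_on G\<^esub> n = g [^]\<^bsub>GL\<^esub> n" for n :: int
    using GL.int_pow_consistent[OF G g(1)] by simp
  with g(2) have G_eq: "G = range (\<lambda>n::int. g [^]\<^bsub>GL\<^esub> n)" by simp
  have "invertible g" using subgroup.mem_carrier[OF G g(1)] by simp
  then interpret dense_cyclic_group T g
    using assms(1,5,8) G_eq by unfold_locales auto
  show ?thesis
  proof (intro conjI ballI allI impI)
    show "n = 0 \<or> n = 1" by (rule additive_dim_le_1[OF assms(3)])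
    fix Tc S assume "Tc \<in> connected_components_of (zariski_GL T)" "S \<subseteq> G \<inter> Tc \<and> infinite S"
    then show "zariski_dense S Tc"
      using infinite_subset_dense[of Tc S] G_eq unfolding G_def by simp
  qed
qed

end
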